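(* For every (fixed) $k\ge 2$ and every C2RPQ $\gamma$, the infinitary union $\mathrm{App}^{\star}_{\mathcal{T}w_k}(\gamma)$ is equivalent to the union $\mathrm{App}^{\star,\leq\ell}_{\mathcal{T}w_k}(\gamma)$, where $\ell=\Theta\big(\|\gamma\|_{\mathrm{at}}^2\cdot(k+1)^{\|\gamma\|_{\mathrm{at}}}\big)$ and $\|\gamma\|_{\mathrm{at}}$ denotes the number of atoms of $\gamma$.
   Context: Fix a finite alphabet $\mathbb{A}$. A graph database $G$ is a finite directed edge-labelled graph with node set $V(G)$ and edge set $E(G)\subseteq V(G)\times\mathbb{A}\times V(G)$. Let $\mathbb{A}^\pm=\mathbb{A}\cup\{a^-: a\in\mathbb{A}\}$, and let $G^\pm$ be obtained from $G$ by adding an edge $y\xrightarrow{a^-}x$ for every edge $x\xrightarrow{a}y$ of $G$. A C2RPQ $\gamma(z_1,\dots,z_n)$ consists of a tuple of output variables (repetitions allowed) and a finite conjunction $\bigwedge_{j=1}^m x_j\xrightarrow{L_j}y_j$ ($m\ge 0$) of atoms, each $L_j$ being a regular language over $\mathbb{A}^\pm$ given by an NFA $\mathcal{A}_{L_j}$; non-output variables are existentially quantified. A tuple $(u_1,\dots,u_n)$ satisfies $\gamma$ on $G$ if there is a map $f$ from the variables of $\gamma$ to $V(G)$ with $f(z_i)=u_i$ for all $i$ and such that for every $j$ there is a (possibly empty) directed path in $G^\pm$ from $f(x_j)$ to $f(y_j)$ labelled by a word of $L_j$. A (possibly infinite) set of C2RPQs of the same output arity is interpreted as a union, and two unions are equivalent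 if they are satisfied by the same tuples on every graph database. The tree-width of a C2RPQ is that of its underlying multigraph (vertices are the variables, one edge per atom). $\mathcal{T}w_k$ is the class of C2RPQs of tree-width at most $k$. Refinements. $\mathcal{A}[q,q']$ denotes the language recognized by the NFA $\mathcal{A}$ with $q$ as only initial and $q'$ as only final state. For $m\geq 1$, an atom $m$-refinement of an atom $x\xrightarrow{L}y$ is any query $x\xrightarrow{L_1}t_1\xrightarrow{L_2}\cdots\xrightarrow{L_{n-1}}t_{n-1}\xrightarrow{L_n}y$ with $1\le n\le m$, $t_1,\dots,t_{n-1}$ fresh existentially quantified variables, such that there are states $q_0,\dots,q_n$ of $\mathcal{A}_L$ with $q_0$ initial, $q_n$ final, and each $L_i$ is either $\mathcal{A}_L[q_{i-1},q_i]$, or $\{a\}$ for a letter $a\in\mathbb{A}$ belonging to $\mathcal{A}_L[q_{i-1},q_i]$, or $\{a^-\}$ for some $a^-$ belonging to $\mathcal{A}_L[q_{i-1},q_i]$ (with $t\xrightarrow{a^-}t'$ standing for $t'\xrightarrow{a}t$). Additionally, if $\varepsilon\in L$, the equality atom $x=y$ is an atom $m$-refinement. An $m$-refinement of $\gamma$ is obtained by replacing every atom by one of its atom $m$-refinements and then collapsing variables forced to be equal by equality atoms. $\mathrm{Ref}^{\leq m}(\gamma)$ is the set of $m$-refinements of $\gamma$ and $\mathrm{Ref}(\gamma)=\bigcup_m\mathrm{Ref}^{\leq m}(\gamma)$. Homomorphisms. A homomorphism from a C2RPQ $\rho(x_1,\dots,x_r)$ to $\alpha(y_1,\dots,y_r)$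 is a map $f$ between their variables with $f(x_i)=y_i$ for all $i$ and such that $f(x)\xrightarrow{L}f(y)$ is an atom of $\alpha$ for every atom $x\xrightarrow{L}y$ of $\rho$; it is strong onto if every atom of $\alpha$ is of the form $f(x)\xrightarrow{L}f(y)$ for some atom $x\xrightarrow{L}y$ of $\rho$. For a class $\mathcal{C}$ of C2RPQs, $\mathrm{App}^{\star}_{\mathcal{C}}(\gamma)$ is the set of all $\alpha\in\mathcal{C}$ such that there is a strong onto homomorphism from some $\rho\in\mathrm{Ref}(\gamma)$ to $\alpha$; $\mathrm{App}^{\star,\leq m}_{\mathcal{C}}(\gamma)$ is defined in the same way with $\rho\in\mathrm{Ref}^{\leq m}(\gamma)$. *)

theory Defs
  imports Complex_Main "HOL-Library.Landau_Symbols"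
begin

section \<open>Labelled paths, automata, graph databases\<close>

inductive lpath :: "('v \<times> 'l \<times> 'v) set \<Rightarrow> 'v \<Rightarrow> 'l list \<Rightarrow> 'v \<Rightarrow> bool"
  for E :: "('v \<times> 'l \<times> 'v) set" where
  lpath_Nil: "lpath E u [] u"
| lpath_Cons: "(u, l, v) \<in> E \<Longrightarrow> lpath E v w z \<Longrightarrow> lpath E u (l # w) z"

text \<open>The two-way alphabet: \<open>Pos a\<close> is the letter \<open>a\<close>, \<open>Neg a\<close> is its inverse.\<close>

datatype 'a signed = Pos 'a | Neg 'a

text \<open>The concrete type of states (and, below, of database nodes and of query variables) is
  immaterial since only finitely many of them occur in any one object; \<open>nat\<close> always leaves room
  for fresh variables.\<close>

record 'l nfa =
  states :: "nat set"
  initial :: "nat set"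
  delta :: "(nat \<times> 'l \<times> nat) set"
  final :: "nat set"

definition is_nfa :: "'l nfa \<Rightarrow> bool" where
  "is_nfa A \<longleftrightarrow> finite (states A) \<and> initial A \<subseteq> states A \<and> final A \<subseteq> states A \<and>
     delta A \<subseteq> states A \<times> UNIV \<times> states A"

definition lang :: "'l nfa \<Rightarrow> 'l list set" where
  "lang A = {w. \<exists>q \<in> initial A. \<exists>q' \<in> final A. lpath (delta A) q w q'}"

definition nfa_between :: "'l nfa \<Rightarrow> nat \<Rightarrow> nat \<Rightarrow> 'l nfa" where
  "nfa_between A q q' = A\<lparr>initial := {q}, final := {q'}\<rparr>"

definition letter_nfa :: "'l \<Rightarrow> 'l nfa" where
  "letter_nfa l = \<lparr>states = {0, 1}, initial = {0}, delta = {(0, l, 1)}, final = {1}\<rparr>"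

record 'a gdb =
  nodes :: "nat set"
  edges :: "(nat \<times> 'a \<times> nat) set"

definition is_gdb :: "'a gdb \<Rightarrow> bool" where
  "is_gdb G \<longleftrightarrow> finite (nodes G) \<and> finite (edges G) \<and> edges G \<subseteq> nodes G \<times> UNIV \<times> nodes G"

definition pm_edges :: "'a gdb \<Rightarrow> (nat \<times> 'a signed \<times> nat) set" where
  "pm_edges G = {(x, Pos a, y) | x a y. (x, a, y) \<in> edges G} \<union>
                {(y, Neg a, x) | x a y. (x, a, y) \<in> edges G}"


section \<open>C2RPQs\<close>

type_synonym 'a atom = "nat \<times> 'a signed nfa \<times> nat"

text \<open>The set of variables is part of a query, because collapsing the two ends of an equality
  atom may leave a variable that occurs in no atom. Atoms form a list, i.e. a conjunction indexed
  by \<open>j = 1, \<dots>, m\<close>, so that repeated atoms are counted and refined separately.\<close>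

record 'a query =
  outs :: "nat list"
  vars :: "nat set"
  atoms :: "'a atom list"

definition is_c2rpq :: "'a query \<Rightarrow> bool" where
  "is_c2rpq \<gamma> \<longleftrightarrow> finite (vars \<gamma>) \<and> set (outs \<gamma>) \<subseteq> vars \<gamma> \<and>
     (\<forall>(x, A, y) \<in> set (atoms \<gamma>). x \<in> vars \<gamma> \<and> y \<in> vars \<gamma> \<and> is_nfa A)"

definition num_atoms :: "'a query \<Rightarrow> nat" where
  "num_atoms \<gamma> = length (atoms \<gamma>)"

text \<open>Atoms with automata replaced by the languages they recognize.\<close>

definition lang_atoms :: "'a query \<Rightarrow> (nat \<times> 'a signed list set \<times> nat) set" where
  "lang_atoms \<gamma> = (\<lambda>(x, A, y). (x, lang A, y)) ` set (atoms \<gamma>)"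

definition satisfies :: "'a gdb \<Rightarrow> nat list \<Rightarrow> 'a query \<Rightarrow> bool" where
  "satisfies G us \<gamma> \<longleftrightarrow>
     (\<exists>f. f ` vars \<gamma> \<subseteq> nodes G \<and> map f (outs \<gamma>) = us \<and>
          (\<forall>(x, L, y) \<in> lang_atoms \<gamma>. \<exists>w \<in> L. lpath (pm_edges G) (f x) w (f y)))"

definition equivalent_unions :: "'a query set \<Rightarrow> 'a query set \<Rightarrow> bool" where
  "equivalent_unions \<Gamma> \<Delta> \<longleftrightarrow>
     (\<forall>G us. is_gdb G \<longrightarrow> ((\<exists>\<gamma> \<in> \<Gamma>. satisfies G us \<gamma>) \<longleftrightarrow> (\<exists>\<delta> \<in> \<Delta>. satisfies G us \<delta>)))"


section \<open>Tree-width\<close>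

definition is_cycle :: "(nat \<times> nat) set \<Rightarrow> nat list \<Rightarrow> bool" where
  "is_cycle F p \<longleftrightarrow> 3 \<le> length p \<and> distinct p \<and>
     (\<forall>i. Suc i < length p \<longrightarrow> (p ! i, p ! Suc i) \<in> F) \<and> (last p, hd p) \<in> F"

definition connected_in :: "(nat \<times> nat) set \<Rightarrow> nat set \<Rightarrow> bool" where
  "connected_in F S \<longleftrightarrow> S \<noteq> {} \<and> (\<forall>s \<in> S. \<forall>t \<in> S. (s, t) \<in> (F \<inter> S \<times> S)\<^sup>*)"

definition is_tree :: "nat set \<Rightarrow> (nat \<times> nat) set \<Rightarrow> bool" where
  "is_tree N F \<longleftrightarrow> finite N \<and> F \<subseteq> N \<times> N \<and> sym F \<and> irrefl F \<and> connected_in F N \<and>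
     (\<nexists>p. is_cycle F p)"

definition tree_decomposition ::
    "'a query \<Rightarrow> nat set \<Rightarrow> (nat \<times> nat) set \<Rightarrow> (nat \<Rightarrow> nat set) \<Rightarrow> bool" where
  "tree_decomposition \<gamma> N F bag \<longleftrightarrow> is_tree N F \<and> (\<forall>t \<in> N. bag t \<subseteq> vars \<gamma>) \<and>
     (\<forall>x \<in> vars \<gamma>. connected_in F {t \<in> N. x \<in> bag t}) \<and>
     (\<forall>(x, A, y) \<in> set (atoms \<gamma>). \<exists>t \<in> N. x \<in> bag t \<and> y \<in> bag t)"

definition width :: "nat set \<Rightarrow> (nat \<Rightarrow> nat set) \<Rightarrow> nat" where
  "width N bag = Max ((\<lambda>t. card (bag t)) ` N) - 1"

definition treewidth :: "'a query \<Rightarrow> nat" where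
  "treewidth \<gamma> = (LEAST w. \<exists>N F bag. tree_decomposition \<gamma> N F bag \<and> w = width N bag)"

definition Tw :: "nat \<Rightarrow> 'a query set" where
  "Tw k = {\<alpha>. is_c2rpq \<alpha> \<and> treewidth \<alpha> \<le> k}"


section \<open>Refinements\<close>

text \<open>\<open>refine_step A q q' t t' e\<close>: the atom \<open>e\<close> may be put between \<open>t\<close> and \<open>t'\<close> for the part of a
  run of \<open>A\<close> from \<open>q\<close> to \<open>q'\<close>. An inverse letter read from \<open>t\<close> to \<open>t'\<close> becomes
  an atom from \<open>t'\<close> to \<open>t\<close>.\<close>

definition refine_step ::
    "'a signed nfa \<Rightarrow> nat \<Rightarrow> nat \<Rightarrow> nat \<Rightarrow> nat \<Rightarrow> 'a atom \<Rightarrow> bool" where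
  "refine_step A q q' t t' e \<longleftrightarrow>
     e = (t, nfa_between A q q', t') \<or>
     (\<exists>a. [Pos a] \<in> lang (nfa_between A q q') \<and> e = (t, letter_nfa (Pos a), t')) \<or>
     (\<exists>a. [Neg a] \<in> lang (nfa_between A q q') \<and> e = (t', letter_nfa (Pos a), t))"

definition path_refinement ::
    "nat \<Rightarrow> 'a atom \<Rightarrow> nat list \<Rightarrow> 'a atom list \<Rightarrow> bool" where
  "path_refinement m e ts es \<longleftrightarrow> (case e of (x, A, y) \<Rightarrow>
     1 \<le> length es \<and> length es \<le> m \<and> length es = Suc (length ts) \<and>
     (\<exists>qs. length qs = Suc (length es) \<and> set qs \<subseteq> states A \<and>
           hd qs \<in> initial A \<and> last qs \<in> final A \<and>
           (\<forall>i < length es. refine_step A (qs ! i) (qs ! Suc i)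
              ((x # ts @ [y]) ! i) ((x # ts @ [y]) ! Suc i) (es ! i))))"

text \<open>An atom refinement is a triple: its inner variables, its regular atoms, and its
  equality atoms.\<close>

definition atom_refinements ::
    "nat \<Rightarrow> 'a atom \<Rightarrow> (nat list \<times> 'a atom list \<times> (nat \<times> nat) set) set" where
  "atom_refinements m e =
     {(ts, es, {}) | ts es. path_refinement m e ts es} \<union>
     (case e of (x, A, y) \<Rightarrow> if [] \<in> lang A then {([], [], {(x, y)})} else {})"

text \<open>In \<open>Ref_le\<close>, \<open>h\<close> names the classes of variables identified by the equality atoms \<open>Q\<close>; any
  naming is allowed, so \<open>Ref_le m \<gamma>\<close> is closed under renaming of variables.\<close>

definition Ref_le :: "nat \<Rightarrow> 'a query \<Rightarrow> 'a query set" where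
  "Ref_le m \<gamma> = {\<rho>. \<exists>rs h.
     list_all2 (\<lambda>e r. r \<in> atom_refinements m e) (atoms \<gamma>) rs \<and>
     (let fresh = concat (map (\<lambda>(ts, es, eqs). ts) rs);
          es' = concat (map (\<lambda>(ts, es, eqs). es) rs);
          Q = (\<Union>(ts, es, eqs) \<in> set rs. eqs);
          V = vars \<gamma> \<union> set fresh
      in distinct fresh \<and> set fresh \<inter> vars \<gamma> = {} \<and>
         (\<forall>x \<in> V. \<forall>y \<in> V. h x = h y \<longleftrightarrow> (x, y) \<in> (Q \<union> Q\<inverse>)\<^sup>*) \<and>
         \<rho> = \<lparr>outs = map h (outs \<gamma>), vars = h ` V,
              atoms = map (\<lambda>(x, A, y). (h x, A, h y)) es'\<rparr>)}"

definition Ref :: "'a query \<Rightarrow> 'a query set" where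
  "Ref \<gamma> = (\<Union>m \<in> {1..}. Ref_le m \<gamma>)"


section \<open>Homomorphisms and approximations\<close>

definition query_hom :: "(nat \<Rightarrow> nat) \<Rightarrow> 'a query \<Rightarrow> 'a query \<Rightarrow> bool" where
  "query_hom f \<rho> \<alpha> \<longleftrightarrow> f ` vars \<rho> \<subseteq> vars \<alpha> \<and> map f (outs \<rho>) = outs \<alpha> \<and>
     (\<forall>(x, L, y) \<in> lang_atoms \<rho>. (f x, L, f y) \<in> lang_atoms \<alpha>)"

definition strong_onto_hom :: "(nat \<Rightarrow> nat) \<Rightarrow> 'a query \<Rightarrow> 'a query \<Rightarrow> bool" where
  "strong_onto_hom f \<rho> \<alpha> \<longleftrightarrow> query_hom f \<rho> \<alpha> \<and>
     (\<forall>e \<in> lang_atoms \<alpha>. \<exists>(x, L, y) \<in> lang_atoms \<rho>. e = (f x, L, f y))"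

definition App_star :: "'a query set \<Rightarrow> 'a query \<Rightarrow> 'a query set" where
  "App_star C \<gamma> = {\<alpha> \<in> C. \<exists>\<rho> \<in> Ref \<gamma>. \<exists>f. strong_onto_hom f \<rho> \<alpha>}"

definition App_star_le :: "'a query set \<Rightarrow> nat \<Rightarrow> 'a query \<Rightarrow> 'a query set" where
  "App_star_le C m \<gamma> = {\<alpha> \<in> C. \<exists>\<rho> \<in> Ref_le m \<gamma>. \<exists>f. strong_onto_hom f \<rho> \<alpha>}"

end

theory Submission
  imports Defs "HOL-Library.Sublist" "HOL-Library.FuncSet"
begin

text \<open>
  Fix a tree decomposition of an approximation \<open>\<alpha>\<close> that holds on a database. The refined atoms of
  \<open>\<gamma>\<close> become walks in \<open>\<alpha>\<close> whose steps lie inside bags, and replacing a stretch of such a walk by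
  one atom \<open>\<A>[q, q']\<close> keeps the query true. Hence it suffices to shorten a family of walks while
  keeping the tree-width at most \<open>k\<close>. If a bag meets a walk in two non-consecutive positions, jump
  between them. Otherwise a long walk runs through a long chain of nested separations, each with at
  most \<open>k\<close> common vertices. Colour the vertices with \<open>k + 1\<close> colours, injectively on every bag, and
  record for every separation the colours of the vertices where the walks cross it, and the number
  of endpoints of walks lying to its left. By pigeonhole two distant separations agree; the part
  between them is removed, the crossing walks jump from one to the other, and equality of colours
  allows the two separators to be joined by a path of bags in which one vertex at a time is
  exchanged.
\<close>

section \<open>Acyclic families of bags\<close>

text \<open>The new query keeps the variables and the valuation of \<open>\<alpha>\<close>; only its
  atoms change. A jump is always true on the database, because the words of consecutive steps can be
  concatenated. So truth puts no condition on the stretch that is skipped, and states of the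
  automata never have to be compared: this is why the bound depends only on \<open>k\<close> and the
  number of atoms. The obstacle is the tree-width. All crossing walks must be cut at the same two
  separators, where they may share vertices. Since a colouring is injective on each separator,
  equality of colours is a consistent partial matching of the two separators, whichever walks run
  through a vertex. An endpoint of a walk has to survive every cut, so none may lie strictly between
  the two separations; this is what counting endpoints ensures. The bound \<open>k\<close> instead
  of \<open>k + 1\<close> on a separator leaves the free place that the exchange of vertices
  needs.\<close>

inductive join_tree :: "'v set \<Rightarrow> 'v set set \<Rightarrow> bool" for C where
  root: "join_tree C {C}"
| leaf: "join_tree C \<B> \<Longrightarrow> D \<in> \<B> \<Longrightarrow> B \<inter> \<Union>\<B> \<subseteq> D \<Longrightarrow> join_tree C (insert B \<B>)"

text \<open>These are the alpha-acyclic hypergraphs, given by the running-intersection property.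
  Working with sets of bags instead of trees on nodes allows gluing and splitting without any
  renaming of nodes.\<close>

definition acyclic_family :: "'v set set \<Rightarrow> bool" where
  "acyclic_family \<B> \<longleftrightarrow> (\<exists>C. join_tree C \<B>)"

lemma join_tree_root_in: "join_tree C \<B> \<Longrightarrow> C \<in> \<B>"
  by (induction rule: join_tree.induct) auto

text \<open>\<open>\<R>\<close> is rebuilt on top of \<open>\<L>\<close>: its root \<open>C'\<close>
  becomes a leaf at \<open>D\<close>, and every later bag keeps its old attachment, since whatever
  it shares with \<open>\<L>\<close> already lies in \<open>C'\<close>.\<close>

lemma join_tree_glue:
  assumes "join_tree C' \<R>" "join_tree C \<L>" "D \<in> \<L>" "\<Union>\<L> \<inter> \<Union>\<R> \<subseteq> D \<inter> C'"
  shows "join_tree C (\<L> \<union> \<R>)"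
  using assms
proof (induction rule: join_tree.induct)
  case root
  then have "join_tree C (insert C' \<L>)"
    by (intro join_tree.leaf) auto
  then show ?case by simp
next
  case (leaf \<B> E B)
  then have "join_tree C (\<L> \<union> \<B>)" by auto
  moreover have "C' \<in> \<B>" using leaf join_tree_root_in by blast
  then have "B \<inter> \<Union>(\<L> \<union> \<B>) \<subseteq> E" using leaf by blast
  ultimately have "join_tree C (insert B (\<L> \<union> \<B>))"
    using leaf by (intro join_tree.leaf) auto
  then show ?case by simp
qed

text \<open>The one new case is the bag \<open>B\<close> added last. It is then taken as a family of
  its own, onto which the older bags, rooted at the neighbour \<open>E\<close> of \<open>B\<close>,
  are glued.\<close>

lemma join_tree_reroot:
  assumes "join_tree C \<B>" "D \<in> \<B>"
  shows "join_tree D \<B>"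
  using assms
proof (induction arbitrary: D rule: join_tree.induct)
  case root
  then show ?case by (auto intro: join_tree.root)
next
  case (leaf \<B> E B)
  show ?case
  proof (cases "D \<in> \<B>")
    case True
    then show ?thesis using leaf by (intro join_tree.leaf) auto
  next
    case False
    then have "D = B" using leaf by auto
    have "join_tree B ({B} \<union> \<B>)"
      using leaf by (intro join_tree_glue[of E \<B> B "{B}" B]) (auto intro: join_tree.root)
    then show ?thesis using \<open>D = B\<close> by simp
  qed
qed

section \<open>Acyclic families without a distinguished root: gluing, splitting, colouring\<close>

lemma acyclic_family_singleton: "acyclic_family {B}"
  unfolding acyclic_family_def by (blast intro: join_tree.root)

lemma acyclic_family_insert:
  "acyclic_family \<B> \<Longrightarrow> D \<in> \<B> \<Longrightarrow> B \<inter> \<Union>\<B> \<subseteq> D \<Longrightarrow> acyclic_family (insert B \<B>)"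
  unfolding acyclic_family_def by (blast intro: join_tree.leaf)

lemma acyclic_family_glue:
  assumes "acyclic_family \<L>" "acyclic_family \<R>" "D \<in> \<L>" "E \<in> \<R>" "\<Union>\<L> \<inter> \<Union>\<R> \<subseteq> D \<inter> E"
  shows "acyclic_family (\<L> \<union> \<R>)"
  using assms join_tree_glue join_tree_reroot unfolding acyclic_family_def by metis

lemma acyclic_family_induct [consumes 1, case_names singleton insert]:
  assumes "acyclic_family \<B>"
    and "\<And>B. P {B}"
    and "\<And>\<B> D B. acyclic_family \<B> \<Longrightarrow> P \<B> \<Longrightarrow> D \<in> \<B> \<Longrightarrow> B \<inter> \<Union>\<B> \<subseteq> D \<Longrightarrow> P (insert B \<B>)"
  shows "P \<B>"
proof -
  obtain C where "join_tree C \<B>" using assms(1) unfolding acyclic_family_def by blast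
  then show ?thesis
    by (induction rule: join_tree.induct) (use assms acyclic_family_def in blast)+
qed

text \<open>A cut leaves vertices that lie in no bag, whereas a tree decomposition has to cover
  every variable. Each missing vertex becomes a singleton bag, which may be attached
  anywhere.\<close>

lemma acyclic_family_cover:
  assumes "finite V" "acyclic_family \<B>" "\<Union>\<B> \<subseteq> V" "\<forall>B\<in>\<B>. finite B \<and> card B \<le> Suc k"
  obtains \<B>' where "acyclic_family \<B>'" "\<Union>\<B>' = V" "\<B> \<subseteq> \<B>'" "\<forall>B\<in>\<B>'. finite B \<and> card B \<le> Suc k"
proof -
  have "\<exists>\<B>'. acyclic_family \<B>' \<and> \<Union>\<B>' = \<Union>\<B> \<union> U \<and> \<B> \<subseteq> \<B>' \<and> (\<forall>B\<in>\<B>'. finite B \<and> card B \<le> Suc k)"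
    if "finite U" for U
    using that
  proof induction
    case empty
    then show ?case using assms by (intro exI[of _ \<B>]) auto
  next
    case (insert x U)
    then obtain \<B>' where B': "acyclic_family \<B>'" "\<Union>\<B>' = \<Union>\<B> \<union> U" "\<B> \<subseteq> \<B>'"
      "\<forall>B\<in>\<B>'. finite B \<and> card B \<le> Suc k" by blast
    show ?case
    proof (cases "x \<in> \<Union>\<B>'")
      case True
      then show ?thesis using B' by (intro exI[of _ \<B>']) auto
    next
      case False
      obtain D where "D \<in> \<B>'" using B'(1) join_tree_root_in unfolding acyclic_family_def by blast
      then have "acyclic_family (insert {x} \<B>')"
        using B' False by (intro acyclic_family_insert) auto
      then show ?thesis using B' by (intro exI[of _ "insert {x} \<B>'"]) auto
    qed
  qed
  from this[OF assms(1)] assms(3) that show ?thesis by (metis sup.absorb2)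
qed

text \<open>With \<open>C\<close> as root, the vertex \<open>x\<close> is lost somewhere on the way
  from \<open>B\<close> to the root, between a bag \<open>T\<close> and the next bag
  \<open>T'\<close>. Removing this link splits the family into the two sides.\<close>

lemma acyclic_family_separation:
  assumes "acyclic_family \<B>" "B \<in> \<B>" "C \<in> \<B>" "x \<in> B" "x \<notin> C"
  obtains \<L> \<R> T T' where "\<L> \<union> \<R> = \<B>" "acyclic_family \<L>" "acyclic_family \<R>"
    "T \<in> \<L>" "T' \<in> \<R>" "\<Union>\<L> \<inter> \<Union>\<R> \<subseteq> T \<inter> T'" "B \<in> \<L>" "C \<in> \<R>" "x \<in> T" "x \<notin> T'"
proof -
  have "join_tree C \<B>"
    using assms join_tree_reroot unfolding acyclic_family_def by blast
  then have "\<exists>\<L> \<R> T T'. \<L> \<union> \<R> = \<B> \<and> acyclic_family \<L> \<and> acyclic_family \<R> \<and> T \<in> \<L> \<and> T' \<in> \<R> \<and>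
    \<Union>\<L> \<inter> \<Union>\<R> \<subseteq> T \<inter> T' \<and> B \<in> \<L> \<and> C \<in> \<R> \<and> x \<in> T \<and> x \<notin> T'"
    using assms(2,4)
  proof (induction arbitrary: B rule: join_tree.induct)
    case root
    then show ?case using assms(5) by auto
  next
    case (leaf \<B> D A)
    \<comment> \<open>The new leaf \<open>A\<close> joins the side of its neighbour
      \<open>D\<close>. If \<open>B\<close> is \<open>A\<close> itself and \<open>x\<close> is still
      in \<open>D\<close>, the separation found for \<open>D\<close> serves for
      \<open>B\<close>.\<close>
    have insert_leaf: ?case if B: "B' \<in> \<B>" "x \<in> B'" "B' = B \<or> (B = A \<and> B' = D)" for B'
    proof -
      obtain \<L> \<R> T T' where IH: "\<L> \<union> \<R> = \<B>" "acyclic_family \<L>" "acyclic_family \<R>"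
        "T \<in> \<L>" "T' \<in> \<R>" "\<Union>\<L> \<inter> \<Union>\<R> \<subseteq> T \<inter> T'" "B' \<in> \<L>" "C \<in> \<R>" "x \<in> T" "x \<notin> T'"
        using leaf.IH[OF B(1,2)] by blast
      show ?thesis
      proof (cases "D \<in> \<L>")
        case True
        then have "acyclic_family (insert A \<L>)"
          using IH leaf by (intro acyclic_family_insert) auto
        moreover have "\<Union>(insert A \<L>) \<inter> \<Union>\<R> \<subseteq> T \<inter> T'"
          using IH(1,6) True leaf.hyps(3) by blast
        moreover have "insert A \<L> \<union> \<R> = insert A \<B>" "B \<in> insert A \<L>" "T \<in> insert A \<L>"
          using IH(1,4,7) B(3) by blast+
        ultimately show ?thesis using IH(3,5,8-10) by meson
      next
        case False
        then have D: "D \<in> \<R>" using IH leaf.hyps by blast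
        then have "acyclic_family (insert A \<R>)"
          using IH leaf by (intro acyclic_family_insert) auto
        moreover have "\<Union>\<L> \<inter> \<Union>(insert A \<R>) \<subseteq> T \<inter> T'"
          using IH(6) D leaf.hyps(3) IH(1) by blast
        moreover have "B \<in> \<L>" using B(3) False IH(7) by blast
        moreover have "\<L> \<union> insert A \<R> = insert A \<B>" "C \<in> insert A \<R>" "T' \<in> insert A \<R>"
          using IH(1,5,8) by blast+
        ultimately show ?thesis using IH(2,4,9,10) by meson
      qed
    qed
    show ?case
    proof (cases "B \<in> \<B>")
      case True
      then show ?thesis using insert_leaf leaf by blast
    next
      case False
      then have [simp]: "B = A" using leaf by auto
      show ?thesis
      proof (cases "x \<in> D")
        case True
        then show ?thesis using insert_leaf leaf by blast
      next
        case False
        \<comment> \<open>Here \<open>x\<close> is lost on the very link between \<open>A\<close>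
          and \<open>D\<close>, so \<open>{A}\<close> is the whole left side.\<close>
        have "acyclic_family \<B>" using leaf unfolding acyclic_family_def by blast
        moreover have "C \<in> \<B>" using leaf join_tree_root_in by blast
        moreover have "{A} \<union> \<B> = insert A \<B>" "\<Union>{A} \<inter> \<Union>\<B> \<subseteq> A \<inter> D"
          using leaf.hyps(3) by auto
        moreover have "A \<in> {A}" "B \<in> {A}" "x \<in> A" using leaf.prems by auto
        ultimately show ?thesis
          using False leaf.hyps(2) acyclic_family_singleton[of A] by meson
      qed
    qed
  qed
  then show ?thesis using that by blast
qed

text \<open>Greedy colouring along the construction: the coloured part of a new bag lies in a single
  earlier bag, so it is coloured injectively, and among \<open>k + 1\<close> colours enough remain
  for the other vertices of the bag.\<close>

lemma acyclic_family_colouring: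
  fixes \<B> :: "'v set set"
  assumes "acyclic_family \<B>" "\<forall>B\<in>\<B>. finite B \<and> card B \<le> Suc k"
  obtains col :: "'v \<Rightarrow> nat" where "\<forall>v. col v \<le> k" "\<forall>B\<in>\<B>. inj_on col B"
proof -
  have extend: "\<exists>c'. (\<forall>v. c' v \<le> k) \<and> (\<forall>v\<in>U. c' v = c v) \<and> inj_on c' B"
    if "finite B" "card B \<le> Suc k" "\<forall>v. c v \<le> k" "inj_on c (B \<inter> U)" for B U and c :: "'v \<Rightarrow> nat"
  proof -
    have "card (c ` (B \<inter> U)) = card (B \<inter> U)" using that(4) by (rule card_image)
    moreover have "card ({..k} - c ` (B \<inter> U)) = Suc k - card (c ` (B \<inter> U))"
      using that by (subst card_Diff_subset) auto
    moreover have "card (B - U) = card B - card (B \<inter> U)"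
      using that by (metis card_Diff_subset_Int finite_Int)
    ultimately have "card (B - U) \<le> card ({..k} - c ` (B \<inter> U))" using that by auto
    then have "\<exists>d. d ` (B - U) \<subseteq> {..k} - c ` (B \<inter> U) \<and> inj_on d (B - U)"
      using that(1) by (intro card_le_inj) auto
    then obtain d where d: "d ` (B - U) \<subseteq> {..k} - c ` (B \<inter> U)" "inj_on d (B - U)"
      by blast
    have *: "d v \<le> k" "\<And>u. u \<in> B \<Longrightarrow> u \<in> U \<Longrightarrow> d v \<noteq> c u" if "v \<in> B" "v \<notin> U" for v
      using d(1) that by blast+
    let ?c = "\<lambda>v. if v \<in> B - U then d v else c v"
    have "inj_on ?c B"
      using *(2) that(4) d(2) by (auto simp: inj_on_def split: if_splits) metis+
    then show ?thesis using that(3) * by (intro exI[of _ ?c]) auto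
  qed
  have "\<exists>c :: 'v \<Rightarrow> nat. (\<forall>v. c v \<le> k) \<and> (\<forall>B\<in>\<B>. inj_on c B)"
    using assms
  proof (induction rule: acyclic_family_induct)
    case (singleton B)
    then show ?case using extend[of B "\<lambda>_. 0" "{}"] by auto
  next
    case (insert \<B> D B)
    then obtain c :: "'v \<Rightarrow> nat" where c: "\<forall>v. c v \<le> k" "\<forall>B\<in>\<B>. inj_on c B" by auto
    have "inj_on c (B \<inter> \<Union>\<B>)" using c insert by (meson inj_on_subset)
    then obtain c' where c': "\<forall>v. c' v \<le> k" "\<forall>v\<in>\<Union>\<B>. c' v = c v" "inj_on c' B"
      using extend[of B c "\<Union>\<B>"] insert c by auto
    have "inj_on c' A" if "A \<in> \<B>" for A
      using c(2) c'(2) that by (auto simp: inj_on_def)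
    then show ?case using c' by auto
  qed
  then show ?thesis using that by blast
qed

text \<open>Exchanging the vertices of \<open>X\<close> for those of \<open>Y\<close> one at a time needs one spare place in a bag.\<close>

lemma exchange_chain:
  assumes "finite X" "finite Y" "card X \<le> k" "inj_on col X" "inj_on col Y" "col ` X = col ` Y"
  obtains \<M> where "acyclic_family \<M>" "X \<in> \<M>" "Y \<in> \<M>" "\<Union>\<M> = X \<union> Y"
    "\<forall>B\<in>\<M>. finite B \<and> card B \<le> Suc k"
    "\<forall>x\<in>X. \<forall>y\<in>Y. col x = col y \<longrightarrow> (\<exists>B\<in>\<M>. x \<in> B \<and> y \<in> B)"
proof -
  have "\<exists>\<M>. acyclic_family \<M> \<and> X \<in> \<M> \<and> Y \<in> \<M> \<and> \<Union>\<M> = X \<union> Y \<and>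
      (\<forall>B\<in>\<M>. finite B \<and> card B \<le> Suc k) \<and>
      (\<forall>x\<in>X. \<forall>y\<in>Y. col x = col y \<longrightarrow> (\<exists>B\<in>\<M>. x \<in> B \<and> y \<in> B))"
    using assms
  proof (induction "card (X - Y)" arbitrary: X rule: less_induct)
    case less
    show ?case
    proof (cases "X \<subseteq> Y")
      case True
      moreover have "card X = card Y" using less.prems by (metis card_image)
      ultimately have "X = Y" using less.prems card_subset_eq by metis
      moreover have "\<forall>x\<in>X. \<forall>y\<in>X. col x = col y \<longrightarrow> x = y"
        using less.prems by (auto simp: inj_on_def)
      ultimately show ?thesis using less.prems acyclic_family_singleton
        by (intro exI[of _ "{X}"]) auto
    next
      case False
      then obtain x where x: "x \<in> X" "x \<notin> Y" by blast
      then have "col x \<in> col ` Y" using less.prems by auto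
      then obtain y where y: "y \<in> Y" "col x = col y" by auto
      have yX: "y \<notin> X" using x y less.prems by (auto simp: inj_on_def)
      \<comment> \<open>\<open>x\<close> is exchanged for the vertex of \<open>Y\<close> with the
        same colour. The set of colours is unchanged and \<open>X'\<close> differs from
        \<open>Y\<close> in fewer elements.\<close>
      define X' where "X' = insert y (X - {x})"
      have "card (X' - Y) < card (X - Y)"
        unfolding X'_def using x y less.prems by (intro psubset_card_mono) auto
      moreover have "card X' \<le> k"
        unfolding X'_def using less.prems(1,3) x(1) yX card_Suc_Diff1[of X x] by simp
      moreover have "inj_on col X'"
        unfolding X'_def using less.prems(4) x y yX
        by (auto simp: inj_on_def)
      moreover have "col ` X' = col ` Y"
        using less.prems(6) x(1) y(2) insert_Diff[of x X] image_insert[of col x "X - {x}"]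
        unfolding X'_def by simp
      ultimately obtain \<M> where M: "acyclic_family \<M>" "X' \<in> \<M>" "Y \<in> \<M>" "\<Union>\<M> = X' \<union> Y"
        "\<forall>B\<in>\<M>. finite B \<and> card B \<le> Suc k"
        "\<forall>x\<in>X'. \<forall>y\<in>Y. col x = col y \<longrightarrow> (\<exists>B\<in>\<M>. x \<in> B \<and> y \<in> B)"
        using less.hyps[of X'] less.prems X'_def by auto
      \<comment> \<open>This intermediate bag contains the matched pair \<open>x\<close>,
        \<open>y\<close> and is where the spare place is used. As \<open>x\<close> is outside
        \<open>Y\<close>, it does not occur in \<open>\<M>\<close>, so \<open>?Z\<close> can be
        attached at \<open>X'\<close>.\<close>
      let ?Z = "insert y X"
      have "acyclic_family (insert ?Z \<M>)"
        using M x by (intro acyclic_family_insert[of _ X']) (auto simp: X'_def)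
      then have "acyclic_family (insert X (insert ?Z \<M>))"
        by (rule acyclic_family_insert[of _ ?Z]) auto
      moreover have "\<exists>B\<in>insert X (insert ?Z \<M>). u \<in> B \<and> v \<in> B"
        if "u \<in> X" "v \<in> Y" "col u = col v" for u v
      proof (cases "u = x")
        case True
        then have "v = y" using that y less.prems by (auto simp: inj_on_def)
        then show ?thesis using that by auto
      next
        case False
        then show ?thesis using M(6) that X'_def by auto
      qed
      moreover have "card ?Z \<le> Suc k" using less.prems yX by simp
      ultimately show ?thesis using M less.prems x y
        by (intro exI[of _ "insert X (insert ?Z \<M>)"]) (auto simp: X'_def)
    qed
  qed
  then show ?thesis using that by blast
qed


section \<open>Tree decompositions as acyclic families\<close>

lemma connected_in_delete_leaf:
  assumes "connected_in F S" "sym F" "a \<noteq> b" "\<forall>c. (b, c) \<in> F \<longrightarrow> c = a" "S - {b} \<noteq> {}"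
  shows "connected_in F (S - {b})"
proof -
  let ?R = "F \<inter> (S - {b}) \<times> (S - {b})"
  \<comment> \<open>While the path stands on the leaf \<open>b\<close>, the invariant speaks about
    \<open>a\<close> instead, because \<open>b\<close> can be left only through
    \<open>a\<close>.\<close>
  have "if u = b then (s, a) \<in> ?R\<^sup>* else (s, u) \<in> ?R\<^sup>*"
    if "(s, u) \<in> (F \<inter> S \<times> S)\<^sup>*" "s \<noteq> b" for s u
    using that
  proof (induction rule: rtrancl_induct)
    case base
    then show ?case by simp
  next
    case (step u v)
    show ?case
    proof (cases "v = b")
      case True
      then have "u = a" using step assms(2,4) by (auto dest: symD)
      then show ?thesis using step True assms(3) by simp
    next
      case False
      show ?thesis
      proof (cases "u = b")
        case True
        then show ?thesis using step assms(4) False by auto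
      next
        case u: False
        then have "(s, u) \<in> ?R\<^sup>*" "(u, v) \<in> ?R" using step False by auto
        then show ?thesis using False by (simp add: rtrancl.rtrancl_into_rtrancl)
      qed
    qed
  qed
  then show ?thesis
    using assms(1,5) unfolding connected_in_def by (metis DiffD1 DiffD2 insertI1)
qed

lemma connected_in_leaf_neighbour:
  assumes "connected_in F S" "\<forall>c. (b, c) \<in> F \<longrightarrow> c = a" "b \<in> S" "s \<in> S" "s \<noteq> b"
  shows "a \<in> S"
proof -
  have "(b, s) \<in> (F \<inter> S \<times> S)\<^sup>*" using assms unfolding connected_in_def by blast
  then obtain c where "(b, c) \<in> F \<inter> S \<times> S" using assms(5) by (metis converse_rtranclE)
  then show ?thesis using assms(2) by auto
qed

lemma connected_in_insert_leaf:
  assumes "connected_in F S" "a \<in> S"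
  shows "connected_in (F \<union> {(a, b), (b, a)}) (insert b S)"
proof -
  let ?R = "(F \<union> {(a, b), (b, a)}) \<inter> insert b S \<times> insert b S"
  have "(F \<inter> S \<times> S)\<^sup>* \<subseteq> ?R\<^sup>*" by (rule rtrancl_mono) auto
  moreover have "(a, b) \<in> ?R" "(b, a) \<in> ?R" using assms(2) by auto
  ultimately have "(s, a) \<in> ?R\<^sup>* \<and> (a, s) \<in> ?R\<^sup>*" if "s \<in> insert b S" for s
    using that assms unfolding connected_in_def by blast
  then have "(s, t) \<in> ?R\<^sup>*" if "s \<in> insert b S" "t \<in> insert b S" for s t
    using that by (meson rtrancl_trans)
  then show ?thesis unfolding connected_in_def by blast
qed

lemma connected_in_restrict:
  "S \<subseteq> N \<Longrightarrow> connected_in (F \<inter> N \<times> N) S \<longleftrightarrow> connected_in F S"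
proof -
  assume "S \<subseteq> N"
  then have "F \<inter> N \<times> N \<inter> S \<times> S = F \<inter> S \<times> S" by auto
  then show ?thesis unfolding connected_in_def by simp
qed

lemma connected_in_mono: "connected_in F S \<Longrightarrow> F \<subseteq> F' \<Longrightarrow> connected_in F' S"
  unfolding connected_in_def by (meson Int_mono order_refl rtrancl_mono subsetD)

lemma is_cycle_mono: "is_cycle F p \<Longrightarrow> F \<subseteq> F' \<Longrightarrow> is_cycle F' p"
  unfolding is_cycle_def by blast

text \<open>The last node of a longest path is a leaf: a neighbour off the path would extend the
  path, and a neighbour on it other than the predecessor would close a cycle.\<close>

lemma tree_leaf:
  assumes "is_tree N F" "2 \<le> card N"
  obtains a b where "a \<in> N" "b \<in> N" "a \<noteq> b" "(a, b) \<in> F" "\<forall>c. (b, c) \<in> F \<longrightarrow> c = a"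
proof -
  have tree: "finite N" "F \<subseteq> N \<times> N" "sym F" "irrefl F" "connected_in F N" "\<nexists>p. is_cycle F p"
    using assms(1) unfolding is_tree_def by auto
  define path where "path p \<longleftrightarrow> set p \<subseteq> N \<and> distinct p \<and>
    (\<forall>i. Suc i < length p \<longrightarrow> (p ! i, p ! Suc i) \<in> F)" for p
  obtain s t where st: "s \<in> N" "t \<in> N" "s \<noteq> t"
    using assms(2) by (metis card_le_Suc0_iff_eq not_less_eq_eq numeral_2_eq_2 tree(1))
  then have "(s, t) \<in> (F \<inter> N \<times> N)\<^sup>*" using tree(5) unfolding connected_in_def by blast
  then obtain c where c: "(s, c) \<in> F" "c \<in> N" using st by (metis IntD1 IntD2 SigmaD2 converse_rtranclE)
  then have "s \<noteq> c" using tree(4) by (auto simp: irrefl_def)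
  then have "path [s, c]" using st c by (auto simp: path_def)
  moreover have "length p \<le> card N" if "path p" for p
    using that tree(1) unfolding path_def by (metis card_mono distinct_card)
  ultimately obtain p where p: "path p" "\<And>q. path q \<Longrightarrow> length q \<le> length p"
    using ex_has_greatest_nat[of path "[s, c]" length "Suc (card N)"] by (metis less_Suc_eq_le)
  have len: "2 \<le> length p" using p(2)[OF \<open>path [s, c]\<close>] by simp
  define n where "n = length p - 2"
  have n: "length p = Suc (Suc n)" using len n_def by simp
  let ?a = "p ! n" and ?b = "p ! Suc n"
  have ab: "(?a, ?b) \<in> F" "?a \<in> N" "?b \<in> N" "?a \<noteq> ?b"
    using p(1) n unfolding path_def by (auto simp: nth_eq_iff_index_eq)
  have "d = ?a" if "(?b, d) \<in> F" for d
  proof (rule ccontr)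
    assume "d \<noteq> ?a"
    have "d \<in> N" using that tree(2) by auto
    have "d \<in> set p"
    proof (rule ccontr)
      assume "d \<notin> set p"
      then have "path (p @ [d])"
        using p(1) \<open>d \<in> N\<close> that n unfolding path_def
        by (auto simp: nth_append less_Suc_eq)
      then show False using p(2) by fastforce
    qed
    then obtain i where i: "i < length p" "d = p ! i" by (metis in_set_conv_nth)
    have "i \<noteq> Suc n" using that i tree(4) by (auto simp: irrefl_def)
    then have "i < n" using i n \<open>d \<noteq> ?a\<close> by (metis less_SucE)
    have "is_cycle F (drop i p)"
      unfolding is_cycle_def
    proof (intro conjI allI impI)
      show "3 \<le> length (drop i p)" using n \<open>i < n\<close> by simp
      show "distinct (drop i p)" using p(1) by (simp add: path_def)
      show "(drop i p ! j, drop i p ! Suc j) \<in> F" if "Suc j < length (drop i p)" for j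
        using that p(1) by (simp add: path_def)
      have "last (drop i p) = ?b" using n \<open>i < n\<close> by (simp add: last_conv_nth)
      moreover have "hd (drop i p) = d" using i by (simp add: hd_drop_conv_nth)
      ultimately show "(last (drop i p), hd (drop i p)) \<in> F" using that by simp
    qed
    then show False using tree(6) by blast
  qed
  then show ?thesis using that ab by blast
qed

text \<open>Leaves are peeled off. By connectedness, a vertex that the leaf's bag shares with any
  other bag is also in the bag of its neighbour, which is the running-intersection condition. The
  hypothesis is restricted to vertices that occur, because a vertex may occur in the deleted bag
  only.\<close>

lemma tree_acyclic_family:
  assumes "is_tree N F" "\<And>x. {t \<in> N. x \<in> bag t} \<noteq> {} \<Longrightarrow> connected_in F {t \<in> N. x \<in> bag t}"
  shows "acyclic_family (bag ` N)"
  using assms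
proof (induction "card N" arbitrary: N F rule: less_induct)
  case less
  have tree: "finite N" "F \<subseteq> N \<times> N" "sym F" "irrefl F" "connected_in F N" "\<nexists>p. is_cycle F p"
    using less.prems(1) unfolding is_tree_def by auto
  have "N \<noteq> {}" using tree(5) unfolding connected_in_def by blast
  show ?case
  proof (cases "2 \<le> card N")
    case False
    then have "card N = 1" using tree(1) \<open>N \<noteq> {}\<close> by (metis One_nat_def Suc_1 card_gt_0_iff le_antisym not_less_eq_eq Suc_leI)
    then obtain t where "N = {t}" by (auto simp: card_1_singleton_iff)
    then show ?thesis by (simp add: acyclic_family_singleton)
  next
    case True
    obtain a b where ab: "a \<in> N" "b \<in> N" "a \<noteq> b" "(a, b) \<in> F" "\<forall>c. (b, c) \<in> F \<longrightarrow> c = a"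
      using tree_leaf[OF less.prems(1) True] .
    define N' where "N' = N - {b}"
    define F' where "F' = F \<inter> N' \<times> N'"
    have conn: "connected_in F' (S - {b})" if "connected_in F S" "S \<subseteq> N" "S - {b} \<noteq> {}" for S
      using connected_in_delete_leaf[OF that(1) tree(3) ab(3,5) that(3)] that(2)
      unfolding F'_def by (subst connected_in_restrict) (auto simp: N'_def)
    have "N' \<noteq> {}" using ab N'_def by auto
    then have "connected_in F' N'" using conn[OF tree(5)] N'_def by auto
    moreover have "\<nexists>p. is_cycle F' p" using tree(6) is_cycle_mono[of F' _ F] F'_def by blast
    moreover have "sym F'" "irrefl F'" "F' \<subseteq> N' \<times> N'" "finite N'"
      using tree unfolding F'_def N'_def by (auto simp: sym_def irrefl_def)
    ultimately have "is_tree N' F'" unfolding is_tree_def by blast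
    moreover have "connected_in F' {t \<in> N'. x \<in> bag t}" if "{t \<in> N'. x \<in> bag t} \<noteq> {}" for x
    proof -
      have *: "{t \<in> N'. x \<in> bag t} = {t \<in> N. x \<in> bag t} - {b}" by (auto simp: N'_def)
      show ?thesis using that unfolding * by (intro conn less.prems(2)) auto
    qed
    moreover have "card N' < card N" unfolding N'_def using ab tree by (intro card_Diff1_less)
    ultimately have "acyclic_family (bag ` N')" using less.hyps by blast
    moreover have "bag b \<inter> \<Union>(bag ` N') \<subseteq> bag a"
    proof
      fix x assume "x \<in> bag b \<inter> \<Union>(bag ` N')"
      then obtain t where t: "t \<in> N'" "x \<in> bag t" "x \<in> bag b" by auto
      let ?S = "{t \<in> N. x \<in> bag t}"
      have "b \<in> ?S" "t \<in> ?S" "t \<noteq> b" using t ab by (auto simp: N'_def)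
      then have "a \<in> ?S"
        using connected_in_leaf_neighbour[OF less.prems(2) ab(5), of x t] by blast
      then show "x \<in> bag a" by simp
    qed
    moreover have "bag a \<in> bag ` N'" using ab N'_def by auto
    ultimately have "acyclic_family (insert (bag b) (bag ` N'))"
      using acyclic_family_insert by blast
    moreover have "insert (bag b) (bag ` N') = bag ` N" using ab by (auto simp: N'_def)
    ultimately show ?thesis by simp
  qed
qed

lemma is_tree_insert_leaf:
  assumes "is_tree N F" "a \<in> N" "b \<notin> N"
  shows "is_tree (insert b N) (F \<union> {(a, b), (b, a)})"
proof -
  let ?F = "F \<union> {(a, b), (b, a)}"
  have tree: "finite N" "F \<subseteq> N \<times> N" "sym F" "irrefl F" "connected_in F N" "\<nexists>p. is_cycle F p"
    using assms(1) unfolding is_tree_def by auto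
  have nb: "c = a" if "(b, c) \<in> ?F \<or> (c, b) \<in> ?F" for c
    using that tree(2) assms by auto
  have False if p: "is_cycle ?F p" for p
  proof (cases "b \<in> set p")
    case False
    have "p \<noteq> []" using p by (auto simp: is_cycle_def)
    have "is_cycle F p"
      unfolding is_cycle_def
    proof (intro conjI allI impI)
      show "3 \<le> length p" "distinct p" using p by (auto simp: is_cycle_def)
      show "(p ! i, p ! Suc i) \<in> F" if "Suc i < length p" for i
      proof -
        have "(p ! i, p ! Suc i) \<in> ?F" using that p by (auto simp: is_cycle_def)
        moreover have "p ! i \<noteq> b" "p ! Suc i \<noteq> b" using that False by (metis nth_mem Suc_lessD)+
        ultimately show ?thesis by auto
      qed
      have "last p \<noteq> b" "hd p \<noteq> b" using False \<open>p \<noteq> []\<close> by auto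
      then show "(last p, hd p) \<in> F" using p by (auto simp: is_cycle_def)
    qed
    then show False using tree(6) by blast
  next
    case True
    then obtain i where i: "i < length p" "p ! i = b" by (metis in_set_conv_nth)
    have len: "3 \<le> length p" "distinct p" using p by (auto simp: is_cycle_def)
    have step: "(p ! j, p ! Suc j) \<in> ?F" if "Suc j < length p" for j
      using that p unfolding is_cycle_def by blast
    have wrap: "(p ! (length p - 1), p ! 0) \<in> ?F"
      using p len unfolding is_cycle_def
      by (metis hd_conv_nth last_conv_nth length_0_conv not_numeral_le_zero)
    \<comment> \<open>\<open>s\<close> and \<open>r\<close> are the positions cyclically after and
      before \<open>b\<close>. Both carry \<open>a\<close>, the only neighbour of \<open>b\<close>,
      yet they differ because a cycle has at least three nodes.\<close>
    define s where "s = (if Suc i = length p then 0 else Suc i)"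
    define r where "r = (if i = 0 then length p - 1 else i - 1)"
    have "(b, p ! s) \<in> ?F"
    proof (cases "Suc i = length p")
      case True
      then have "length p - 1 = i" by simp
      then show ?thesis using wrap i True by (simp add: s_def)
    next
      case False
      then show ?thesis using step[of i] i by (simp add: s_def)
    qed
    moreover have "(p ! r, b) \<in> ?F"
      using step[of "i - 1"] wrap i by (cases "i = 0") (auto simp: r_def)
    ultimately have "p ! s = p ! r" using nb by metis
    moreover have "s < length p" "r < length p" "s \<noteq> r" using i len by (auto simp: s_def r_def)
    ultimately show False using len(2) nth_eq_iff_index_eq by blast
  qed
  moreover have "connected_in ?F (insert b N)"
    using connected_in_insert_leaf[OF tree(5) assms(2)] .
  moreover have "sym ?F" using tree(3) by (auto simp: sym_def)
  moreover have "irrefl ?F" using tree(4) assms by (auto simp: irrefl_def)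
  ultimately show ?thesis using tree assms unfolding is_tree_def by blast
qed

lemma acyclic_family_tree:
  fixes \<B> :: "'v set set"
  assumes "acyclic_family \<B>"
  obtains N F and bag :: "nat \<Rightarrow> 'v set" where "is_tree N F" "bag ` N = \<B>"
    "\<And>x. x \<in> \<Union>\<B> \<Longrightarrow> connected_in F {t \<in> N. x \<in> bag t}"
proof -
  have "\<exists>N F (bag :: nat \<Rightarrow> 'v set). is_tree N F \<and> bag ` N = \<B> \<and>
    (\<forall>x\<in>\<Union>\<B>. connected_in F {t \<in> N. x \<in> bag t})"
    using assms
  proof (induction rule: acyclic_family_induct)
    case (singleton B)
    have "is_tree {0} {}" unfolding is_tree_def
      by (auto simp: connected_in_def is_cycle_def sym_def irrefl_def)
    moreover have "connected_in {} {t \<in> {0::nat}. x \<in> B}" if "x \<in> B" for x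
      using that by (auto simp: connected_in_def)
    ultimately show ?case by (intro exI[of _ "{0}"] exI[of _ "{}"] exI[of _ "\<lambda>_. B"]) auto
  next
    case (insert \<B> D B)
    then obtain N F and bag :: "nat \<Rightarrow> 'v set" where IH: "is_tree N F" "bag ` N = \<B>"
      "\<forall>x\<in>\<Union>\<B>. connected_in F {t \<in> N. x \<in> bag t}" by blast
    obtain a where a: "a \<in> N" "bag a = D" using IH(2) insert.hyps by auto
    have "finite N" using IH(1) unfolding is_tree_def by blast
    then obtain b where b: "b \<notin> N" using ex_new_if_finite infinite_UNIV_nat by blast
    let ?F = "F \<union> {(a, b), (b, a)}" and ?bag = "bag(b := B)"
    have "is_tree (insert b N) ?F" using is_tree_insert_leaf IH(1) a b by blast
    moreover have "?bag ` insert b N = insert B \<B>" using IH(2) b by (auto simp: image_iff)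
    moreover have "connected_in ?F {t \<in> insert b N. x \<in> ?bag t}" if x: "x \<in> \<Union>(insert B \<B>)" for x
    proof -
      let ?S = "{t \<in> N. x \<in> bag t}"
      have S: "{t \<in> insert b N. x \<in> ?bag t} = (if x \<in> B then insert b ?S else ?S)"
        using b by auto
      show ?thesis
      proof (cases "x \<in> \<Union>\<B>")
        case True
        then have *: "connected_in F ?S" using IH(3) by blast
        show ?thesis
        proof (cases "x \<in> B")
          case xB: True
          then have "a \<in> ?S" using True insert.hyps a by blast
          then show ?thesis unfolding S using connected_in_insert_leaf[OF *] xB by simp
        next
          case False
          then show ?thesis unfolding S using connected_in_mono[OF *, of ?F] by auto
        qed
      next
        case False
        then have "x \<in> B" "?S = {}" using x IH(2) by auto
        then show ?thesis unfolding S by (auto simp: connected_in_def)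
      qed
    qed
    ultimately show ?case by blast
  qed
  then show ?thesis using that by blast
qed

text \<open>From here on tree-width is handled through sets of bags alone.\<close>

lemma treewidth_le_iff:
  assumes "finite (vars \<gamma>)" "\<forall>(x, A, y)\<in>set (atoms \<gamma>). x \<in> vars \<gamma> \<and> y \<in> vars \<gamma>"
  shows "treewidth \<gamma> \<le> k \<longleftrightarrow> (\<exists>\<B>. acyclic_family \<B> \<and> \<Union>\<B> = vars \<gamma> \<and>
    (\<forall>B\<in>\<B>. card B \<le> Suc k) \<and> (\<forall>(x, A, y)\<in>set (atoms \<gamma>). \<exists>B\<in>\<B>. x \<in> B \<and> y \<in> B))"
    (is "_ \<longleftrightarrow> ?R")
proof
  let ?P = "\<lambda>w. \<exists>N F bag. tree_decomposition \<gamma> N F bag \<and> w = width N bag"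
  have least: "treewidth \<gamma> = (LEAST w. ?P w)" by (rule treewidth_def)
  {
    assume "treewidth \<gamma> \<le> k"
    have "is_tree {0} {}" unfolding is_tree_def
      by (auto simp: connected_in_def is_cycle_def sym_def irrefl_def)
    \<comment> \<open>One bag with all variables shows that some width exists, so that the
      \<open>LEAST\<close> is attained.\<close>
    then have "tree_decomposition \<gamma> {0} {} (\<lambda>_. vars \<gamma>)"
      unfolding tree_decomposition_def using assms by (auto simp: connected_in_def)
    then have "\<exists>w. ?P w" by blast
    then have "?P (treewidth \<gamma>)" unfolding least by (rule LeastI_ex)
    then obtain N F bag where td: "tree_decomposition \<gamma> N F bag" and "treewidth \<gamma> = width N bag"
      by blast
    with \<open>treewidth \<gamma> \<le> k\<close> have "width N bag \<le> k" by simp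
    from td have N: "is_tree N F" "finite N" "\<forall>t\<in>N. bag t \<subseteq> vars \<gamma>"
      unfolding tree_decomposition_def is_tree_def by auto
    have conn: "connected_in F {t \<in> N. x \<in> bag t}" if "x \<in> vars \<gamma>" for x
      using td that unfolding tree_decomposition_def by blast
    have "acyclic_family (bag ` N)"
    proof (intro tree_acyclic_family[OF N(1)] conn)
      fix x assume "{t \<in> N. x \<in> bag t} \<noteq> {}"
      then show "x \<in> vars \<gamma>" using N(3) by blast
    qed
    moreover have "\<Union>(bag ` N) = vars \<gamma>"
    proof
      show "\<Union>(bag ` N) \<subseteq> vars \<gamma>" using N(3) by blast
      show "vars \<gamma> \<subseteq> \<Union>(bag ` N)"
      proof
        fix x assume "x \<in> vars \<gamma>"
        then have "{t \<in> N. x \<in> bag t} \<noteq> {}" using conn unfolding connected_in_def by simp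
        then show "x \<in> \<Union>(bag ` N)" by auto
      qed
    qed
    moreover have "card (bag t) \<le> Suc k" if "t \<in> N" for t
    proof -
      have "card (bag t) \<le> Max ((\<lambda>t. card (bag t)) ` N)" using that N(2) by simp
      then show ?thesis using \<open>width N bag \<le> k\<close> unfolding width_def by linarith
    qed
    moreover have "\<forall>(x, A, y)\<in>set (atoms \<gamma>). \<exists>B\<in>bag ` N. x \<in> B \<and> y \<in> B"
    proof clarify
      fix x A y assume "(x, A, y) \<in> set (atoms \<gamma>)"
      then have "\<exists>t\<in>N. x \<in> bag t \<and> y \<in> bag t" using td unfolding tree_decomposition_def by blast
      then show "\<exists>B\<in>bag ` N. x \<in> B \<and> y \<in> B" by blast
    qed
    ultimately show ?R by blast
  }
  {
    assume ?R
    then obtain \<B> where B: "acyclic_family \<B>" "\<Union>\<B> = vars \<gamma>" "\<forall>B\<in>\<B>. card B \<le> Suc k"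
      "\<forall>(x, A, y)\<in>set (atoms \<gamma>). \<exists>B\<in>\<B>. x \<in> B \<and> y \<in> B" by blast
    obtain N F and bag :: "nat \<Rightarrow> nat set" where N: "is_tree N F" "bag ` N = \<B>"
      "\<And>x. x \<in> \<Union>\<B> \<Longrightarrow> connected_in F {t \<in> N. x \<in> bag t}"
      using acyclic_family_tree[OF B(1)] by blast
    have fin: "finite N" "N \<noteq> {}" using N(1) unfolding is_tree_def connected_in_def by auto
    have "tree_decomposition \<gamma> N F bag"
      unfolding tree_decomposition_def
    proof (intro conjI ballI N(1))
      show "bag t \<subseteq> vars \<gamma>" if "t \<in> N" for t
        using that unfolding N(2)[symmetric] B(2)[symmetric] by blast
      show "connected_in F {t \<in> N. x \<in> bag t}" if "x \<in> vars \<gamma>" for x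
        using that N(3)[of x] B(2) by simp
      show "case e of (x, A, y) \<Rightarrow> \<exists>t\<in>N. x \<in> bag t \<and> y \<in> bag t" if "e \<in> set (atoms \<gamma>)" for e
      proof (cases e)
        case (fields x A y)
        then have "\<exists>B\<in>bag ` N. x \<in> B \<and> y \<in> B" using bspec[OF B(4) that] N(2) by simp
        then show ?thesis using fields by auto
      qed
    qed
    then have "?P (width N bag)" by blast
    then have "treewidth \<gamma> \<le> width N bag" unfolding least by (rule Least_le)
    also have "Max ((\<lambda>t. card (bag t)) ` N) \<le> Suc k"
      using fin B(3) N(2) by auto
    then have "width N bag \<le> k" unfolding width_def by linarith
    finally show "treewidth \<gamma> \<le> k" .
  }
qed


section \<open>Walks and separations\<close>

definition walk_in :: "'v set set \<Rightarrow> 'v list \<Rightarrow> bool" where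
  "walk_in \<B> U \<longleftrightarrow> (\<forall>m. Suc m < length U \<longrightarrow> (\<exists>B\<in>\<B>. U ! m \<in> B \<and> U ! Suc m \<in> B))"

text \<open>A tight walk cannot be shortened by a jump inside a single bag.\<close>

definition tight :: "'v set set \<Rightarrow> 'v list \<Rightarrow> bool" where
  "tight \<B> U \<longleftrightarrow> (\<forall>B\<in>\<B>. \<forall>p q. p < q \<longrightarrow> q < length U \<longrightarrow> U ! p \<in> B \<longrightarrow> U ! q \<in> B \<longrightarrow> q = Suc p)"

text \<open>The \<open>max\<close> makes \<open>jump p p\<close> the identity, so walks that are not
  cut fit the same format. A jump from \<open>p\<close> to \<open>Suc p\<close> removes nothing
  either; the list shrinks only from \<open>p + 2 \<le> q\<close> on.\<close>

definition jump :: "nat \<Rightarrow> nat \<Rightarrow> 'b list \<Rightarrow> 'b list" where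
  "jump p q xs = take (Suc p) xs @ drop (max (Suc p) q) xs"

text \<open>Models the removal of one link of a join tree, with ends \<open>T\<close> and
  \<open>T'\<close>.\<close>

definition separation ::
    "'v set set \<Rightarrow> 'v set set \<Rightarrow> 'v set set \<Rightarrow> 'v set \<Rightarrow> 'v set \<Rightarrow> bool" where
  "separation \<B> \<L> \<R> T T' \<longleftrightarrow> \<L> \<union> \<R> = \<B> \<and> acyclic_family \<L> \<and> acyclic_family \<R> \<and>
     T \<in> \<L> \<and> T' \<in> \<R> \<and> \<Union>\<L> \<inter> \<Union>\<R> \<subseteq> T \<inter> T'"

definition first_in :: "'v set \<Rightarrow> 'v list \<Rightarrow> nat" where
  "first_in A U = (LEAST m. m < length U \<and> U ! m \<in> A)"

text \<open>A walk may cross from left to right or from right to left, so the search is for the side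
  opposite to its start. For a walk that never reaches that side the value is arbitrary, but it
  still has a colour, since colourings are bounded by \<open>k\<close> on all vertices.\<close>

definition crossing :: "'v set set \<Rightarrow> 'v set set \<Rightarrow> 'v list \<Rightarrow> 'v" where
  "crossing \<L> \<R> U = U ! first_in (if U ! 0 \<in> \<Union>\<L> then \<Union>\<R> else \<Union>\<L>) U"

section \<open>Jumps, and how tight walks change sides\<close>

lemma tightD:
  "tight \<B> U \<Longrightarrow> B \<in> \<B> \<Longrightarrow> U ! p \<in> B \<Longrightarrow> U ! q \<in> B \<Longrightarrow> p < q \<Longrightarrow> q < length U \<Longrightarrow> q = Suc p"
  unfolding tight_def by blast

lemma walk_inD:
  assumes "walk_in \<B> U" "Suc m < length U"
  obtains B where "B \<in> \<B>" "U ! m \<in> B" "U ! Suc m \<in> B"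
  using assms unfolding walk_in_def by blast

lemma jump_map: "map f (jump p q xs) = jump p q (map f xs)"
  by (simp add: jump_def take_map drop_map)

lemma jump_same: "jump p p xs = xs"
  by (simp add: jump_def)

lemma length_jump: "p \<le> q \<Longrightarrow> q < length xs \<Longrightarrow> length (jump p q xs) = Suc p + (length xs - max (Suc p) q)"
  by (simp add: jump_def)

lemma subseq_jump: "subseq (jump p q xs) xs"
proof -
  have "subseq (take (Suc p) xs @ drop (max (Suc p) q) xs) (take (Suc p) xs @ drop (Suc p) xs)"
  proof (rule list_emb_append_mono)
    have "drop (max (Suc p) q) xs = drop (max (Suc p) q - Suc p) (drop (Suc p) xs)"
      by (simp add: max_def)
    then show "subseq (drop (max (Suc p) q) xs) (drop (Suc p) xs)"
      by (metis suffix_drop suffix_imp_subseq)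
  qed simp
  then show ?thesis by (simp add: jump_def)
qed

lemma hd_jump: "xs \<noteq> [] \<Longrightarrow> hd (jump p q xs) = hd xs"
  by (cases xs) (auto simp: jump_def)

lemma last_jump: "p \<le> q \<Longrightarrow> q < length xs \<Longrightarrow> last (jump p q xs) = last xs"
proof (cases "max (Suc p) q < length xs")
  case True
  then have "drop (max (Suc p) q) xs \<noteq> []" by (simp only: drop_eq_Nil not_le)
  then show ?thesis unfolding jump_def using True by (metis last_appendR last_drop)
next
  case False
  moreover assume "p \<le> q" "q < length xs"
  ultimately have "Suc p = length xs" by simp
  then show ?thesis by (simp add: jump_def)
qed

lemma two_le_length_jump:
  "p \<le> q \<Longrightarrow> q < length xs \<Longrightarrow> 2 \<le> length xs \<Longrightarrow> 2 \<le> length (jump p q xs)"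
  by (cases "p = q") (auto simp: length_jump max_def)

lemma walk_in_jump:
  assumes "p \<le> q" "q < length U"
    and "\<And>m. m < p \<Longrightarrow> \<exists>B\<in>\<B>. U ! m \<in> B \<and> U ! Suc m \<in> B"
    and "\<And>m. q \<le> m \<Longrightarrow> Suc m < length U \<Longrightarrow> \<exists>B\<in>\<B>. U ! m \<in> B \<and> U ! Suc m \<in> B"
    and "p < q \<Longrightarrow> \<exists>B\<in>\<B>. U ! p \<in> B \<and> U ! q \<in> B"
  shows "walk_in \<B> (jump p q U)"
proof (cases "p = q")
  case True
  then have "jump p q U = U" by (simp add: jump_same)
  then show ?thesis
    unfolding walk_in_def using assms(3,4) True by (metis not_le)
next
  case False
  then have pq: "p < q" using assms(1) by simp
  have nth: "jump p q U ! m = (if m \<le> p then U ! m else U ! (m - Suc p + q))"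
    if "m < length (jump p q U)" for m
    using that pq assms(2) by (auto simp: jump_def nth_append max_def add.commute)
  show ?thesis
    unfolding walk_in_def
  proof (intro allI impI)
    fix m assume m: "Suc m < length (jump p q U)"
    then have len: "Suc m < Suc p + (length U - q)" using pq assms(2) by (simp add: length_jump max_def)
    consider "m < p" | "m = p" | "m > p" by linarith
    then show "\<exists>B\<in>\<B>. jump p q U ! m \<in> B \<and> jump p q U ! Suc m \<in> B"
    proof cases
      case 1
      then show ?thesis using nth[of m] nth[of "Suc m"] m assms(3)[of m] by simp
    next
      case 2
      then show ?thesis using nth[of m] nth[of "Suc m"] m assms(5) pq by simp
    next
      case 3
      moreover have "Suc m - Suc p + q = Suc (m - Suc p + q)" using 3 by simp
      ultimately show ?thesis
        using nth[of m] nth[of "Suc m"] m assms(4)[of "m - Suc p + q"] len by simp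
    qed
  qed
qed

lemma first_in:
  assumes "m < length U" "U ! m \<in> A"
  shows "first_in A U < length U" "U ! first_in A U \<in> A" "first_in A U \<le> m"
    "i < first_in A U \<Longrightarrow> U ! i \<notin> A"
proof -
  have *: "first_in A U < length U \<and> U ! first_in A U \<in> A"
    unfolding first_in_def by (rule LeastI[of _ m]) (use assms in simp)
  then show "first_in A U < length U" "U ! first_in A U \<in> A" by auto
  show "first_in A U \<le> m" unfolding first_in_def by (rule Least_le) (use assms in simp)
  show "U ! i \<notin> A" if "i < first_in A U"
    using not_less_Least[of i "\<lambda>m. m < length U \<and> U ! m \<in> A"] that *
    unfolding first_in_def[symmetric] by auto
qed

lemma exists_switch:
  fixes a b :: nat
  assumes "P a" "\<not> P b" "a \<le> b"
  shows "\<exists>r. a \<le> r \<and> r < b \<and> P r \<and> \<not> P (Suc r)"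
  using assms(3,2)
proof (induction b rule: dec_induct)
  case base
  then show ?case using assms(1) by simp
next
  case (step n)
  then show ?case by (cases "P n") (auto intro: less_SucI)
qed

text \<open>Leaving \<open>\<Union>\<R>\<close> and coming back would put two non-consecutive positions into the
  separator, which lies in a single bag.\<close>

lemma tight_no_return:
  assumes "walk_in (\<L> \<union> \<R>) U" "tight (\<L> \<union> \<R>) U" "T \<in> \<L> \<union> \<R>" "\<Union>\<L> \<inter> \<Union>\<R> \<subseteq> T"
    and "a \<le> m" "m \<le> b" "b < length U" "U ! a \<in> \<Union>\<R>" "U ! b \<in> \<Union>\<R>"
  shows "U ! m \<in> \<Union>\<R>"
proof (rule ccontr)
  assume m: "U ! m \<notin> \<Union>\<R>"
  obtain r where r: "a \<le> r" "r < m" "U ! r \<in> \<Union>\<R>" "U ! Suc r \<notin> \<Union>\<R>"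
    using exists_switch[of "\<lambda>i. U ! i \<in> \<Union>\<R>", OF assms(8) m assms(5)] by metis
  obtain s where s: "m \<le> s" "s < b" "U ! s \<notin> \<Union>\<R>" "U ! Suc s \<in> \<Union>\<R>"
    using exists_switch[of "\<lambda>i. U ! i \<notin> \<Union>\<R>", OF m _ assms(6)] assms(9) by metis
  obtain B where "B \<in> \<L> \<union> \<R>" "U ! r \<in> B" "U ! Suc r \<in> B"
    using walk_inD[OF assms(1), of r] r s assms(7) by force
  then have "U ! r \<in> T" using r assms(4) by blast
  moreover obtain B' where "B' \<in> \<L> \<union> \<R>" "U ! s \<in> B'" "U ! Suc s \<in> B'"
    using walk_inD[OF assms(1), of s] s assms(7) by force
  then have "U ! Suc s \<in> T" using s assms(4) by blast
  ultimately have "Suc s = Suc r"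
    using tightD[OF assms(2,3)] r s assms(7) by force
  then show False using r s by simp
qed

text \<open>Both ends of the step are in \<open>\<Union>\<R>\<close> by the preceding lemma. If the
  bag of the step belongs only to \<open>\<L>\<close>, both ends lie in the separator, and
  \<open>T\<close> is a bag of \<open>\<R>\<close> containing them.\<close>

lemma walk_in_side:
  assumes "walk_in (\<L> \<union> \<R>) U" "tight (\<L> \<union> \<R>) U" "T \<in> \<R>" "\<Union>\<L> \<inter> \<Union>\<R> \<subseteq> T"
    and "a \<le> m" "Suc m \<le> b" "b < length U" "U ! a \<in> \<Union>\<R>" "U ! b \<in> \<Union>\<R>"
  shows "\<exists>B\<in>\<R>. U ! m \<in> B \<and> U ! Suc m \<in> B"
proof -
  have "T \<in> \<L> \<union> \<R>" using assms(3) by blast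
  note in_R = tight_no_return[OF assms(1,2) this assms(4) _ _ assms(7,8,9)]
  have "U ! m \<in> \<Union>\<R>" "U ! Suc m \<in> \<Union>\<R>" by (rule in_R; use assms(5,6) in linarith)+
  moreover obtain B where "B \<in> \<L> \<union> \<R>" "U ! m \<in> B" "U ! Suc m \<in> B"
    using walk_inD[OF assms(1) le_less_trans[OF assms(6,7)]] by blast
  ultimately show ?thesis using assms(3,4) by blast
qed

text \<open>\<open>p\<close> and \<open>q\<close> are the first entries into the right sides. A step
  that starts outside a right side uses a bag of the left side, hence the entry vertex is in the
  separator. After \<open>q\<close> a tight walk ending in \<open>\<R>2\<close> cannot leave it.
  Only the stretch from \<open>p\<close> to \<open>q\<close> is left to be jumped over.\<close>

lemma tight_crossing:
  assumes "\<L>1 \<union> \<R>1 = \<B>" "\<L>2 \<union> \<R>2 = \<B>" "\<Union>\<L>2 \<inter> \<Union>\<R>2 \<subseteq> T" "T \<in> \<R>2"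
    and "\<L>1 \<subseteq> \<L>2" "\<R>2 \<subseteq> \<R>1" "walk_in \<B> U" "tight \<B> U"
    and "U ! 0 \<in> \<Union>\<L>1" "U ! (length U - 1) \<in> \<Union>\<R>2" "U \<noteq> []"
    and p_def: "p = first_in (\<Union>\<R>1) U" and q_def: "q = first_in (\<Union>\<R>2) U"
  shows "p \<le> q" "q < length U" "U ! p \<in> \<Union>\<L>1 \<inter> \<Union>\<R>1" "U ! q \<in> \<Union>\<L>2 \<inter> \<Union>\<R>2"
    "m < p \<Longrightarrow> \<exists>B\<in>\<L>1. U ! m \<in> B \<and> U ! Suc m \<in> B"
    "q \<le> m \<Longrightarrow> Suc m < length U \<Longrightarrow> \<exists>B\<in>\<R>2. U ! m \<in> B \<and> U ! Suc m \<in> B"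
proof -
  let ?e = "length U - 1"
  have e: "?e < length U" using assms by simp
  note q = first_in[OF e assms(10), folded q_def]
  have qR1: "U ! q \<in> \<Union>\<R>1" using q(2) assms(6) by blast
  note p = first_in[OF q(1) qR1, folded p_def]
  show "p \<le> q" "q < length U" using p q by auto
  have before: "\<exists>B\<in>\<L>. U ! i \<in> B \<and> U ! Suc i \<in> B"
    if "\<L> \<union> \<R> = \<B>" "Suc i < length U" "U ! i \<notin> \<Union>\<R>" for \<L> \<R> i
    using walk_inD[OF assms(7) that(2)] that by (metis UnE UnionI)
  show "\<exists>B\<in>\<L>1. U ! m \<in> B \<and> U ! Suc m \<in> B" if "m < p"
    by (rule before[OF assms(1)]) (use that p q in auto)
  have in_L: "U ! f \<in> \<Union>\<L>" if "\<L> \<union> \<R> = \<B>" "f < length U" "\<And>i. i < f \<Longrightarrow> U ! i \<notin> \<Union>\<R>"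
    "U ! 0 \<in> \<Union>\<L>" for \<L> \<R> f
  proof (cases f)
    case 0
    then show ?thesis using that by simp
  next
    case (Suc i)
    then show ?thesis using before[OF that(1), of i] that(2,3) by auto
  qed
  show "U ! p \<in> \<Union>\<L>1 \<inter> \<Union>\<R>1" using in_L[OF assms(1), of p] p q assms(9) by auto
  show "U ! q \<in> \<Union>\<L>2 \<inter> \<Union>\<R>2" using in_L[OF assms(2), of q] q assms(5,9) by blast
  show "\<exists>B\<in>\<R>2. U ! m \<in> B \<and> U ! Suc m \<in> B" if "q \<le> m" "Suc m < length U"
    by (rule walk_in_side[of \<L>2 _ _ _ q _ ?e]) (use that assms q in auto)
qed

section \<open>Chains of nested separations along a tight walk\<close>

lemma separationD:
  assumes "separation \<B> \<L> \<R> T T'"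
  shows "\<L> \<union> \<R> = \<B>" "acyclic_family \<L>" "acyclic_family \<R>" "T \<in> \<L>" "T' \<in> \<R>"
    "\<Union>\<L> \<inter> \<Union>\<R> \<subseteq> T" "\<Union>\<L> \<inter> \<Union>\<R> \<subseteq> T'"
  using assms unfolding separation_def by auto

text \<open>By tightness \<open>U ! j\<close> is not in the bag of the next step, so the family can
  be split where \<open>U ! j\<close> disappears between \<open>D\<close> and that bag. If a later
  bag were on the left again, a vertex beyond \<open>Suc j\<close> would share the bag
  \<open>T\<close> with \<open>U ! j\<close>. The free choice of \<open>D\<close> serves to keep a
  prescribed bag on the left.\<close>

lemma advance_separation:
  assumes "acyclic_family \<R>" "tight \<R> U" "j + 2 < length U"
    and bag: "\<And>m. j \<le> m \<Longrightarrow> Suc m < length U \<Longrightarrow> bag m \<in> \<R> \<and> U ! m \<in> bag m \<and> U ! Suc m \<in> bag m"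
    and "D \<in> \<R>" "U ! j \<in> D"
  obtains \<L>' \<R>' T T' where "separation \<R> \<L>' \<R>' T T'" "D \<in> \<L>'" "bag j \<in> \<L>'"
    "\<And>m. j < m \<Longrightarrow> Suc m < length U \<Longrightarrow> bag m \<in> \<R>'" "U ! j \<in> T" "U ! j \<notin> T'"
proof -
  have b1: "bag (Suc j) \<in> \<R>" "U ! Suc j \<in> bag (Suc j)" "U ! Suc (Suc j) \<in> bag (Suc j)"
    using bag[of "Suc j"] assms(3) by auto
  have "U ! j \<notin> bag (Suc j)"
    using tightD[OF assms(2) b1(1) _ b1(3), of j] assms(3) by auto
  then obtain \<L>' \<R>' T T' where *: "\<L>' \<union> \<R>' = \<R>" "acyclic_family \<L>'" "acyclic_family \<R>'"
    "T \<in> \<L>'" "T' \<in> \<R>'" "\<Union>\<L>' \<inter> \<Union>\<R>' \<subseteq> T \<inter> T'" "D \<in> \<L>'" "bag (Suc j) \<in> \<R>'" "U ! j \<in> T" "U ! j \<notin> T'"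
    using acyclic_family_separation[OF assms(1,5) b1(1) assms(6)] by blast
  have bj: "bag j \<in> \<R>" "U ! j \<in> bag j" using bag[of j] assms(3) by auto
  have "bag j \<in> \<L>'" using bj * by blast
  moreover have "bag m \<in> \<R>'" if "j < m" "Suc m < length U" for m
    using Suc_leI[OF that(1)] that(2)
  proof (induction m rule: dec_induct)
    case base
    then show ?case using *(8) by simp
  next
    case (step n)
    have n: "bag n \<in> \<R>'" "U ! Suc n \<in> bag n" "bag (Suc n) \<in> \<R>" "U ! Suc n \<in> bag (Suc n)"
      using step bag[of n] bag[of "Suc n"] by auto
    show ?case
    proof (rule ccontr)
      assume "bag (Suc n) \<notin> \<R>'"
      then have "U ! Suc n \<in> T" using n * by blast
      moreover have "T \<in> \<R>" using * by blast
      ultimately have "Suc n = Suc j" using tightD[OF assms(2) _ *(9), of "Suc n"] step by auto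
      then show False using step by simp
    qed
  qed
  moreover have "separation \<R> \<L>' \<R>' T T'" unfolding separation_def using * by blast
  ultimately show ?thesis using that * by blast
qed

text \<open>Each separation splits the right side of the previous one. The bag \<open>T'\<close> at
  which that side was attached stays on the left, so the old and the new left parts are glued along
  \<open>T\<close> and \<open>T'\<close>. That \<open>U ! j\<close> is in \<open>T j\<close> but not
  in \<open>T' j\<close> makes the separator a proper subset of \<open>T j\<close>.\<close>

lemma nested_separations:
  fixes \<B> :: "'v set set"
  assumes "acyclic_family \<B>" "walk_in \<B> U" "tight \<B> U"
  obtains \<L> \<R> :: "nat \<Rightarrow> 'v set set" and T T' :: "nat \<Rightarrow> 'v set" where
    "\<And>j. j + 2 < length U \<Longrightarrow> separation \<B> (\<L> j) (\<R> j) (T j) (T' j)"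
    "\<And>j. j + 2 < length U \<Longrightarrow> U ! j \<in> T j - T' j"
    "\<And>j. j + 2 < length U \<Longrightarrow> first_in (\<Union>(\<R> j)) U = Suc j"
    "\<And>j. j + 2 < length U \<Longrightarrow> U ! 0 \<in> \<Union>(\<L> j) \<and> U ! (length U - 1) \<in> \<Union>(\<R> j)"
    "\<And>i j. i \<le> j \<Longrightarrow> j + 2 < length U \<Longrightarrow> \<L> i \<subseteq> \<L> j \<and> \<R> j \<subseteq> \<R> i"
proof -
  have "\<forall>m. \<exists>B. Suc m < length U \<longrightarrow> B \<in> \<B> \<and> U ! m \<in> B \<and> U ! Suc m \<in> B"
    using assms(2) unfolding walk_in_def by blast
  then obtain bag where bag: "\<And>m. Suc m < length U \<Longrightarrow> bag m \<in> \<B> \<and> U ! m \<in> bag m \<and> U ! Suc m \<in> bag m"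
    by metis
  define good where "good j s \<longleftrightarrow> (case s of (\<L>, \<R>, T, T') \<Rightarrow> separation \<B> \<L> \<R> T T' \<and>
      (\<forall>m\<le>j. bag m \<in> \<L>) \<and> (\<forall>m>j. Suc m < length U \<longrightarrow> bag m \<in> \<R>) \<and> U ! j \<in> T \<and> U ! j \<notin> T')"
    for j s
  define below where "below s s' \<longleftrightarrow> fst s \<subseteq> fst s' \<and> fst (snd s') \<subseteq> fst (snd s)"
    for s s' :: "'v set set \<times> 'v set set \<times> 'v set \<times> 'v set"
  have "\<exists>f. \<forall>j. (j + 2 < length U \<longrightarrow> good j (f j)) \<and> (Suc j + 2 < length U \<longrightarrow> below (f j) (f (Suc j)))"
  proof (rule dependent_nat_choice)
    have "\<exists>s. good 0 s" if len: "0 + 2 < length U"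
    proof -
      obtain \<L>' \<R>' T T' where *: "separation \<B> \<L>' \<R>' T T'" "bag 0 \<in> \<L>'"
        "\<And>m. 0 < m \<Longrightarrow> Suc m < length U \<Longrightarrow> bag m \<in> \<R>'" "U ! 0 \<in> T" "U ! 0 \<notin> T'"
        by (rule advance_separation[OF assms(1,3) len, of bag "bag 0"]) (use bag len in auto)
      then have "good 0 (\<L>', \<R>', T, T')" unfolding good_def by auto
      then show ?thesis by blast
    qed
    then show "\<exists>s. 0 + 2 < length U \<longrightarrow> good 0 s" by blast
  next
    fix s j assume IH: "j + 2 < length U \<longrightarrow> good j s"
    have "\<exists>s'. good (Suc j) s' \<and> below s s'" if len: "Suc j + 2 < length U"
    proof -
      obtain \<L> \<R> T T' where s: "s = (\<L>, \<R>, T, T')" by (cases s) auto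
      have sep: "separation \<B> \<L> \<R> T T'" and left: "\<forall>m\<le>j. bag m \<in> \<L>"
        and right: "\<forall>m>j. Suc m < length U \<longrightarrow> bag m \<in> \<R>"
        using IH len unfolding s good_def by auto
      note sep = separationD[OF sep]
      have "bag j \<in> \<L>" "bag (Suc j) \<in> \<R>" "U ! Suc j \<in> bag j" "U ! Suc j \<in> bag (Suc j)"
        using left right len bag[of j] bag[of "Suc j"] by auto
      \<comment> \<open>This is what allows \<open>T'\<close> to be chosen as the bag
        \<open>D\<close> in the next advance.\<close>
      then have mem: "U ! Suc j \<in> T'" using sep(7) by blast
      have "tight \<R> U" using assms(3) sep(1) unfolding tight_def by blast
      then obtain \<L>' \<R>' S S' where *: "separation \<R> \<L>' \<R>' S S'" "T' \<in> \<L>'" "bag (Suc j) \<in> \<L>'"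
        "\<And>m. Suc j < m \<Longrightarrow> Suc m < length U \<Longrightarrow> bag m \<in> \<R>'" "U ! Suc j \<in> S" "U ! Suc j \<notin> S'"
        by (rule advance_separation[OF sep(3) _ len, of bag T']) (use right bag sep(5) mem in auto)
      note sep' = separationD[OF *(1)]
      have "acyclic_family (\<L> \<union> \<L>')"
        using sep sep' *(2) by (intro acyclic_family_glue[of _ _ T T']) auto
      moreover have "\<Union>(\<L> \<union> \<L>') \<inter> \<Union>\<R>' \<subseteq> S \<inter> S'"
      proof
        fix x assume x: "x \<in> \<Union>(\<L> \<union> \<L>') \<inter> \<Union>\<R>'"
        have "x \<in> \<Union>\<L>'"
        proof (rule ccontr)
          assume "x \<notin> \<Union>\<L>'"
          then have "x \<in> \<Union>\<L>" "x \<in> \<Union>\<R>" using x sep'(1) by auto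
          then have "x \<in> T'" using sep(7) by blast
          then show False using *(2) \<open>x \<notin> \<Union>\<L>'\<close> by blast
        qed
        then show "x \<in> S \<inter> S'" using x sep'(6,7) by blast
      qed
      moreover have "\<L> \<union> \<L>' \<union> \<R>' = \<B>" using sep(1) sep'(1) by blast
      ultimately have "separation \<B> (\<L> \<union> \<L>') \<R>' S S'"
        unfolding separation_def using sep' by blast
      then have "good (Suc j) (\<L> \<union> \<L>', \<R>', S, S')"
        unfolding good_def using left * by (auto simp: le_Suc_eq)
      moreover have "below s (\<L> \<union> \<L>', \<R>', S, S')"
        unfolding below_def s using sep'(1) by auto
      ultimately show ?thesis by blast
    qed
    then show "\<exists>s'. (Suc j + 2 < length U \<longrightarrow> good (Suc j) s') \<and> (Suc j + 2 < length U \<longrightarrow> below s s')"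
      by blast
  qed
  then obtain f where f: "\<And>j. j + 2 < length U \<Longrightarrow> good j (f j)"
    "\<And>j. Suc j + 2 < length U \<Longrightarrow> below (f j) (f (Suc j))" by blast
  define \<L> where "\<L> j = fst (f j)" for j
  define \<R> where "\<R> j = fst (snd (f j))" for j
  define T where "T j = fst (snd (snd (f j)))" for j
  define T' where "T' j = snd (snd (snd (f j)))" for j
  have inv: "separation \<B> (\<L> j) (\<R> j) (T j) (T' j)" "\<And>m. m \<le> j \<Longrightarrow> bag m \<in> \<L> j"
    "\<And>m. j < m \<Longrightarrow> Suc m < length U \<Longrightarrow> bag m \<in> \<R> j" "U ! j \<in> T j" "U ! j \<notin> T' j"
    if "j + 2 < length U" for j
    using f(1)[OF that] unfolding good_def \<L>_def \<R>_def T_def T'_def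
    by (auto simp: split_beta)
  show ?thesis
  proof (rule that[of \<L> \<R> T T'])
    fix j assume j: "j + 2 < length U"
    note sep = separationD[OF inv(1)[OF j]]
    show "separation \<B> (\<L> j) (\<R> j) (T j) (T' j)" "U ! j \<in> T j - T' j" using inv[OF j] by auto
    have left: "U ! m \<in> \<Union>(\<L> j)" if "m \<le> Suc j" for m
    proof (cases "m \<le> j")
      case True
      then show ?thesis using inv(2)[OF j, of m] bag[of m] j by auto
    next
      case False
      then have "m = Suc j" using that by simp
      then show ?thesis using inv(2)[OF j, of j] bag[of j] j by auto
    qed
    have "bag (Suc j) \<in> \<R> j" "U ! Suc j \<in> bag (Suc j)"
      using inv(3)[OF j, of "Suc j"] bag[of "Suc j"] j by auto
    then have right: "U ! Suc j \<in> \<Union>(\<R> j)" by blast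
    \<comment> \<open>Otherwise \<open>U ! m\<close> and \<open>U ! Suc j\<close> share the bag
      \<open>T' j\<close>; tightness gives \<open>m = j\<close>, but \<open>U ! j\<close> is not in
      \<open>T' j\<close>.\<close>
    have "U ! m \<notin> \<Union>(\<R> j)" if "m \<le> j" for m
    proof
      assume "U ! m \<in> \<Union>(\<R> j)"
      then have m: "U ! m \<in> T' j" using left[of m] that sep(7) by auto
      moreover have "U ! Suc j \<in> T' j" using left[of "Suc j"] right sep(7) by auto
      moreover have "T' j \<in> \<B>" using sep by blast
      ultimately have "Suc j = Suc m" using tightD[OF assms(3), of "T' j" m "Suc j"] that j by auto
      then show False using m inv(5)[OF j] by simp
    qed
    then have "\<not> first_in (\<Union>(\<R> j)) U \<le> j"
      using first_in(2)[OF _ right] j by auto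
    then show "first_in (\<Union>(\<R> j)) U = Suc j"
      using first_in(3)[OF _ right] j by auto
    define n where "n = length U - 2"
    have n: "length U = Suc (Suc n)" using j n_def by simp
    have "bag n \<in> \<R> j" "U ! (length U - 1) \<in> bag n"
      using inv(3)[OF j, of n] bag[of n] j n by auto
    then show "U ! 0 \<in> \<Union>(\<L> j) \<and> U ! (length U - 1) \<in> \<Union>(\<R> j)" using left[of 0] by auto
  next
    fix i j assume "i \<le> j" "j + 2 < length U"
    then show "\<L> i \<subseteq> \<L> j \<and> \<R> j \<subseteq> \<R> i"
    proof (induction j rule: dec_induct)
      case base
      then show ?case by simp
    next
      case (step n)
      have "below (f n) (f (Suc n))" using f(2) step.prems by simp
      moreover have "\<L> i \<subseteq> \<L> n \<and> \<R> n \<subseteq> \<R> i" using step.IH step.prems by simp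
      ultimately show ?case unfolding below_def \<L>_def \<R>_def by blast
    qed
  qed
qed


section \<open>Cutting walks\<close>

text \<open>The part between the separations is replaced by an exchange chain \<open>\<M>\<close>
  leading from one separator to the other, glued between \<open>\<L>1\<close> and
  \<open>\<R>2\<close>. By nesting, a vertex common to both outer sides lies in both
  separators.\<close>

lemma cut_family:
  fixes col :: "'v \<Rightarrow> nat"
  assumes sep1: "separation \<B> \<L>1 \<R>1 T1 T1'" and sep2: "separation \<B> \<L>2 \<R>2 T2 T2'"
    and nested: "\<L>1 \<subseteq> \<L>2" "\<R>2 \<subseteq> \<R>1"
    and bags: "\<forall>B\<in>\<B>. finite B \<and> card B \<le> Suc k" and "card (\<Union>\<L>1 \<inter> \<Union>\<R>1) \<le> k"
    and col: "\<forall>B\<in>\<B>. inj_on col B"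
  obtains \<B>' where "acyclic_family \<B>'" "\<Union>\<B>' \<subseteq> \<Union>\<B>" "\<forall>B\<in>\<B>'. finite B \<and> card B \<le> Suc k"
    "\<L>1 \<subseteq> \<B>'" "\<R>2 \<subseteq> \<B>'"
    "\<forall>x\<in>\<Union>\<L>1 \<inter> \<Union>\<R>1. \<forall>y\<in>\<Union>\<L>2 \<inter> \<Union>\<R>2. col x = col y \<longrightarrow> (\<exists>B\<in>\<B>'. x \<in> B \<and> y \<in> B)"
proof -
  note s1 = separationD[OF sep1] and s2 = separationD[OF sep2]
  define S1 where "S1 = \<Union>\<L>1 \<inter> \<Union>\<R>1"
  define S2 where "S2 = \<Union>\<L>2 \<inter> \<Union>\<R>2"
  \<comment> \<open>The separators may carry different sets of colours. Only vertices whose colour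
    occurs in both are exchanged, which makes \<open>col\<close> map \<open>X\<close> and
    \<open>Y\<close> onto the same set.\<close>
  define X where "X = {x \<in> S1. \<exists>y\<in>S2. col x = col y}"
  define Y where "Y = {y \<in> S2. \<exists>x\<in>S1. col x = col y}"
  have T: "T1 \<in> \<B>" "T2' \<in> \<B>" using s1(1,4) s2(1,5) by auto
  have sub: "S1 \<subseteq> T1" "S2 \<subseteq> T2'" using s1(6) s2(7) by (auto simp: S1_def S2_def)
  have fin: "finite S1" "finite S2" using T sub bags by (meson finite_subset)+
  have XS: "X \<subseteq> S1" "Y \<subseteq> S2" by (auto simp: X_def Y_def)
  have "finite X" "finite Y" using XS fin by (meson finite_subset)+
  moreover have "card X \<le> k"
    using card_mono[OF fin(1) XS(1)] assms(6) unfolding S1_def by linarith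
  moreover have "inj_on col X" "inj_on col Y"
    using col T sub XS by (meson inj_on_subset)+
  moreover have "col ` X = col ` Y"
  proof
    show "col ` X \<subseteq> col ` Y" unfolding X_def Y_def by (auto simp: image_iff)
    show "col ` Y \<subseteq> col ` X" unfolding X_def Y_def by (auto simp: image_iff) metis
  qed
  ultimately obtain \<M> where M: "acyclic_family \<M>" "X \<in> \<M>" "Y \<in> \<M>" "\<Union>\<M> = X \<union> Y"
    "\<forall>B\<in>\<M>. finite B \<and> card B \<le> Suc k"
    "\<forall>x\<in>X. \<forall>y\<in>Y. col x = col y \<longrightarrow> (\<exists>B\<in>\<M>. x \<in> B \<and> y \<in> B)"
    using exchange_chain[of X Y k col] by blast
  \<comment> \<open>A vertex of both separators is matched with itself, so it stays in the chain and
    connects its occurrences in \<open>\<L>1\<close> and \<open>\<R>2\<close>.\<close>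
  have common: "S1 \<inter> S2 \<subseteq> X \<inter> Y" unfolding X_def Y_def by blast
  have S1: "v \<in> S1" if "v \<in> \<Union>\<L>1" "v \<in> \<Union>\<R>2" for v
    using that nested unfolding S1_def by blast
  have S2: "v \<in> S2" if "v \<in> \<Union>\<L>1" "v \<in> \<Union>\<R>2" for v
    using that nested unfolding S2_def by blast
  have LM: "\<Union>\<L>1 \<inter> \<Union>\<M> \<subseteq> X"
  proof
    fix v assume "v \<in> \<Union>\<L>1 \<inter> \<Union>\<M>"
    then have v: "v \<in> \<Union>\<L>1" "v \<in> X \<or> v \<in> Y" using M(4) by auto
    show "v \<in> X"
    proof (rule ccontr)
      assume "v \<notin> X"
      then have "v \<in> S2" using v XS by blast
      moreover have "v \<in> \<Union>\<R>2" using \<open>v \<in> S2\<close> unfolding S2_def by blast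
      ultimately show False using S1[OF v(1)] common \<open>v \<notin> X\<close> by blast
    qed
  qed
  have MR: "\<Union>\<M> \<inter> \<Union>\<R>2 \<subseteq> Y"
  proof
    fix v assume "v \<in> \<Union>\<M> \<inter> \<Union>\<R>2"
    then have v: "v \<in> \<Union>\<R>2" "v \<in> X \<or> v \<in> Y" using M(4) by auto
    show "v \<in> Y"
    proof (rule ccontr)
      assume "v \<notin> Y"
      then have "v \<in> S1" using v XS by blast
      moreover have "v \<in> \<Union>\<L>1" using \<open>v \<in> S1\<close> unfolding S1_def by blast
      ultimately show False using S2[OF _ v(1)] common \<open>v \<notin> Y\<close> by blast
    qed
  qed
  have "acyclic_family (\<L>1 \<union> \<M>)"
  proof (rule acyclic_family_glue[OF s1(2) M(1) s1(4) M(2)])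
    show "\<Union>\<L>1 \<inter> \<Union>\<M> \<subseteq> T1 \<inter> X" using LM XS(1) sub(1) by blast
  qed
  then have "acyclic_family (\<L>1 \<union> \<M> \<union> \<R>2)"
  proof (rule acyclic_family_glue[OF _ s2(3) _ s2(5)])
    show "Y \<in> \<L>1 \<union> \<M>" using M(3) by blast
    have "\<Union>\<L>1 \<inter> \<Union>\<R>2 \<subseteq> Y"
    proof
      fix v assume "v \<in> \<Union>\<L>1 \<inter> \<Union>\<R>2"
      then have "v \<in> S1" "v \<in> S2" using S1 S2 by simp_all
      then show "v \<in> Y" using common by blast
    qed
    then have "\<Union>(\<L>1 \<union> \<M>) \<inter> \<Union>\<R>2 \<subseteq> Y"
      unfolding Union_Un_distrib Int_Un_distrib2 using MR by (rule Un_least)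
    then show "\<Union>(\<L>1 \<union> \<M>) \<inter> \<Union>\<R>2 \<subseteq> Y \<inter> T2'" using XS(2) sub(2) by blast
  qed
  moreover have "\<Union>(\<L>1 \<union> \<M> \<union> \<R>2) \<subseteq> \<Union>\<B>"
  proof -
    have "\<Union>\<M> \<subseteq> \<Union>\<B>" unfolding M(4) using XS sub T by blast
    moreover have "\<L>1 \<subseteq> \<B>" "\<R>2 \<subseteq> \<B>" using s1(1) s2(1) by auto
    ultimately show ?thesis by blast
  qed
  moreover have "\<forall>B\<in>\<L>1 \<union> \<M> \<union> \<R>2. finite B \<and> card B \<le> Suc k"
    using bags M(5) s1(1) s2(1) by blast
  moreover have "\<exists>B\<in>\<L>1 \<union> \<M> \<union> \<R>2. x \<in> B \<and> y \<in> B" if "x \<in> S1" "y \<in> S2" "col x = col y" for x y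
  proof -
    have "x \<in> X" "y \<in> Y" using that unfolding X_def Y_def by auto
    then show ?thesis using M(6) that(3) by blast
  qed
  moreover have "\<L>1 \<subseteq> \<L>1 \<union> \<M> \<union> \<R>2" "\<R>2 \<subseteq> \<L>1 \<union> \<M> \<union> \<R>2" by auto
  ultimately show ?thesis
    using that[folded S1_def S2_def] by metis
qed

text \<open>By \<open>first\<close> and \<open>last\<close>, the ends of a walk with at least two
  vertices lie in \<open>\<Union>\<L>1\<close> or \<open>\<Union>\<R>2\<close>. A walk with both
  ends on the same side stays there by tightness and is left alone; one that changes sides jumps
  between its two crossings, which have the same colour. The last conjunct names the jump of a
  left-to-right walk, so that the long walk can be shown to shrink.\<close>

lemma cut_walk:
  assumes sep1: "separation \<B> \<L>1 \<R>1 T1 T1'" and sep2: "separation \<B> \<L>2 \<R>2 T2 T2'"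
    and nested: "\<L>1 \<subseteq> \<L>2" "\<R>2 \<subseteq> \<R>1"
    and sides: "\<L>1 \<subseteq> \<B>'" "\<R>2 \<subseteq> \<B>'"
    and matched: "\<forall>x\<in>\<Union>\<L>1 \<inter> \<Union>\<R>1. \<forall>y\<in>\<Union>\<L>2 \<inter> \<Union>\<R>2. col x = col y \<longrightarrow> (\<exists>B\<in>\<B>'. x \<in> B \<and> y \<in> B)"
    and U: "walk_in \<B> U" "tight \<B> U" "U \<noteq> []"
    and first: "U ! 0 \<in> \<Union>\<L>2 \<longrightarrow> U ! 0 \<in> \<Union>\<L>1"
    and last: "U ! (length U - 1) \<in> \<Union>\<L>2 \<longrightarrow> U ! (length U - 1) \<in> \<Union>\<L>1"
    and col: "col (crossing \<L>1 \<R>1 U) = col (crossing \<L>2 \<R>2 U)"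
  shows "\<exists>p q. p \<le> q \<and> q < length U \<and> walk_in \<B>' (jump p q U) \<and>
    (U ! 0 \<in> \<Union>\<L>1 \<and> U ! (length U - 1) \<in> \<Union>\<R>2 \<longrightarrow>
      p = first_in (\<Union>\<R>1) U \<and> q = first_in (\<Union>\<R>2) U)"
proof -
  note s1 = separationD[OF sep1] and s2 = separationD[OF sep2]
  let ?e = "length U - 1"
  have U0: "U ! 0 \<in> \<Union>\<B>" if "\<not> length U \<le> 1"
    using walk_inD[OF U(1), of 0] that by (metis One_nat_def UnionI not_le)
  have trivial: "\<exists>p q. p \<le> q \<and> q < length U \<and> walk_in \<B>' (jump p q U)"
    if "walk_in \<B>' U"
    using that U(3) jump_same[of 0 U] by (intro exI[of _ 0]) simp
  \<comment> \<open>A walk with a single vertex may lie in no bag at all, so it is set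
    apart.\<close>
  consider (short) "length U \<le> 1" "\<not> (U ! 0 \<in> \<Union>\<L>1 \<and> U ! ?e \<in> \<Union>\<R>2)"
    | (LR) "U ! 0 \<in> \<Union>\<L>1" "U ! ?e \<in> \<Union>\<R>2"
    | (RL) "U ! 0 \<notin> \<Union>\<L>1" "U ! 0 \<in> \<Union>\<R>2" "U ! ?e \<in> \<Union>\<L>1"
    | (LL) "U ! 0 \<in> \<Union>\<L>1" "U ! ?e \<in> \<Union>\<L>1" "U ! ?e \<notin> \<Union>\<R>2"
    | (RR) "U ! 0 \<in> \<Union>\<R>2" "U ! ?e \<in> \<Union>\<R>2" "U ! 0 \<notin> \<Union>\<L>1"
  proof (cases "length U \<le> 1")
    case True
    then show ?thesis using that by blast
  next
    case False
    then have len: "Suc (?e - 1) < length U" "Suc (?e - 1) = ?e" by auto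
    have "U ! ?e \<in> \<Union>\<B>" using walk_inD[OF U(1) len(1)] len(2) by (metis UnionI)
    then have "U ! ?e \<in> \<Union>\<L>1 \<or> U ! ?e \<in> \<Union>\<R>2" using last s2(1) by blast
    moreover have "U ! 0 \<in> \<Union>\<L>1 \<or> U ! 0 \<in> \<Union>\<R>2" using U0[OF False] first s2(1) by blast
    ultimately show ?thesis using that by blast
  qed
  then show ?thesis
  proof cases
    case short
    then show ?thesis using trivial by (auto simp: walk_in_def)
  next
    case LR
    define p where "p = first_in (\<Union>\<R>1) U"
    define q where "q = first_in (\<Union>\<R>2) U"
    note c = tight_crossing[OF s1(1) s2(1) s2(7) s2(5) nested U(1,2) LR U(3) p_def q_def]
    have "crossing \<L>1 \<R>1 U = U ! p" "crossing \<L>2 \<R>2 U = U ! q"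
      using LR(1) nested(1) unfolding crossing_def p_def q_def by auto
    then have "\<exists>B\<in>\<B>'. U ! p \<in> B \<and> U ! q \<in> B" using matched c(3,4) col by simp
    have "walk_in \<B>' (jump p q U)"
    proof (rule walk_in_jump[OF c(1,2)])
      show "\<exists>B\<in>\<B>'. U ! m \<in> B \<and> U ! Suc m \<in> B" if "m < p" for m
        using bexE[OF c(5)[OF that]] sides(1) by blast
      show "\<exists>B\<in>\<B>'. U ! m \<in> B \<and> U ! Suc m \<in> B" if "q \<le> m" "Suc m < length U" for m
        using bexE[OF c(6)[OF that]] sides(2) by blast
      show "\<exists>B\<in>\<B>'. U ! p \<in> B \<and> U ! q \<in> B" by fact
    qed
    then show ?thesis using c(1,2) p_def q_def by blast
  next
    case RL
    \<comment> \<open>A right-to-left walk meets the second separation first; left and right, and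
      the two separations, exchange their roles.\<close>
    define p where "p = first_in (\<Union>\<L>2) U"
    define q where "q = first_in (\<Union>\<L>1) U"
    have swap: "\<R>2 \<union> \<L>2 = \<B>" "\<R>1 \<union> \<L>1 = \<B>" "\<Union>\<R>1 \<inter> \<Union>\<L>1 \<subseteq> T1"
      using s1(1,6) s2(1) by auto
    note c = tight_crossing[OF swap s1(4) nested(2,1) U(1,2) RL(2,3) U(3) p_def q_def]
    have "U ! 0 \<notin> \<Union>\<L>2" using RL(1) first by blast
    then have "crossing \<L>1 \<R>1 U = U ! q" "crossing \<L>2 \<R>2 U = U ! p"
      using RL(1) unfolding crossing_def p_def q_def by auto
    then have "col (U ! q) = col (U ! p)" using col by simp
    moreover have "U ! q \<in> \<Union>\<L>1 \<inter> \<Union>\<R>1" "U ! p \<in> \<Union>\<L>2 \<inter> \<Union>\<R>2" using c(3,4) by blast+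
    ultimately have "\<exists>B\<in>\<B>'. U ! p \<in> B \<and> U ! q \<in> B" using matched by blast
    have "walk_in \<B>' (jump p q U)"
    proof (rule walk_in_jump[OF c(1,2)])
      show "\<exists>B\<in>\<B>'. U ! m \<in> B \<and> U ! Suc m \<in> B" if "m < p" for m
        using bexE[OF c(5)[OF that]] sides(2) by blast
      show "\<exists>B\<in>\<B>'. U ! m \<in> B \<and> U ! Suc m \<in> B" if "q \<le> m" "Suc m < length U" for m
        using bexE[OF c(6)[OF that]] sides(1) by blast
      show "\<exists>B\<in>\<B>'. U ! p \<in> B \<and> U ! q \<in> B" by fact
    qed
    then show ?thesis using c(1,2) RL(1) by blast
  next
    case LL
    have swap: "\<R>1 \<union> \<L>1 = \<B>" "\<Union>\<R>1 \<inter> \<Union>\<L>1 \<subseteq> T1" using s1(1,6) by auto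
    have "\<exists>B\<in>\<B>'. U ! m \<in> B \<and> U ! Suc m \<in> B" if "Suc m < length U" for m
    proof -
      have "\<exists>B\<in>\<L>1. U ! m \<in> B \<and> U ! Suc m \<in> B"
        by (rule walk_in_side[of \<R>1 \<L>1 U T1 0 m ?e, unfolded swap(1)])
          (use that LL U s1(4) swap(2) in simp_all)
      then show ?thesis using sides by blast
    qed
    then show ?thesis using trivial LL(3) by (auto simp: walk_in_def)
  next
    case RR
    have "\<exists>B\<in>\<B>'. U ! m \<in> B \<and> U ! Suc m \<in> B" if "Suc m < length U" for m
    proof -
      have "\<exists>B\<in>\<R>2. U ! m \<in> B \<and> U ! Suc m \<in> B"
        by (rule walk_in_side[of \<L>2 \<R>2 U T2' 0 m ?e, unfolded s2(1)])
          (use that RR U s2(5,7) in simp_all)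
      then show ?thesis using sides by blast
    qed
    then show ?thesis using trivial RR(3) by (auto simp: walk_in_def)
  qed
qed

text \<open>One round of shortening. The condition \<open>p i + 2 \<le> q i\<close> expresses real
  progress, since a shorter jump removes no vertex.\<close>

lemma reduce_walks:
  fixes Us :: "'i \<Rightarrow> 'v list"
  assumes "finite I" "card I \<le> n" "acyclic_family \<B>" "\<forall>B\<in>\<B>. finite B \<and> card B \<le> Suc k"
    and walks: "\<forall>i\<in>I. walk_in \<B> (Us i) \<and> Us i \<noteq> []"
    and long: "i0 \<in> I" "length (Us i0) > 8 * n\<^sup>2 * (k + 1) ^ n + 2"
  shows "\<exists>\<B>' p q. acyclic_family \<B>' \<and> \<Union>\<B>' \<subseteq> \<Union>\<B> \<and> (\<forall>B\<in>\<B>'. finite B \<and> card B \<le> Suc k) \<and>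
    (\<forall>i\<in>I. p i \<le> q i \<and> q i < length (Us i) \<and> walk_in \<B>' (jump (p i) (q i) (Us i))) \<and>
    (\<exists>i\<in>I. p i + 2 \<le> q i)"
proof (cases "\<forall>i\<in>I. tight \<B> (Us i)")
  case False
  then obtain i where "i \<in> I" "\<not> tight \<B> (Us i)" by blast
  then obtain B p q where i: "i \<in> I" "B \<in> \<B>" "p < q" "q < length (Us i)"
    "Us i ! p \<in> B" "Us i ! q \<in> B" "q \<noteq> Suc p" unfolding tight_def by auto
  \<comment> \<open>The default \<open>jump 0 0\<close> leaves every other walk unchanged.\<close>
  define P Q where "P = (\<lambda>_. 0)(i := p)" and "Q = (\<lambda>_. 0)(i := q)"
  have "P j \<le> Q j \<and> Q j < length (Us j) \<and> walk_in \<B> (jump (P j) (Q j) (Us j))" if "j \<in> I" for j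
  proof (cases "j = i")
    case True
    have "walk_in \<B> (jump p q (Us i))"
      using i walks unfolding walk_in_def[of _ "Us i" for i]
      by (intro walk_in_jump) auto
    then show ?thesis using True i by (simp add: P_def Q_def)
  next
    case False
    then show ?thesis using walks that by (simp add: P_def Q_def jump_same)
  qed
  moreover have "P i + 2 \<le> Q i" using i by (simp add: P_def Q_def)
  ultimately show ?thesis using assms(3,4) i(1) by blast
next
  case True
  let ?U = "Us i0"
  have U: "walk_in \<B> ?U" "tight \<B> ?U" using walks long(1) True by auto
  obtain \<L> \<R> T T' where
      sep: "\<And>j. j + 2 < length ?U \<Longrightarrow> separation \<B> (\<L> j) (\<R> j) (T j) (T' j)"
    and drop: "\<And>j. j + 2 < length ?U \<Longrightarrow> ?U ! j \<in> T j - T' j"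
    and first: "\<And>j. j + 2 < length ?U \<Longrightarrow> first_in (\<Union>(\<R> j)) ?U = Suc j"
    and ends: "\<And>j. j + 2 < length ?U \<Longrightarrow> ?U ! 0 \<in> \<Union>(\<L> j) \<and> ?U ! (length ?U - 1) \<in> \<Union>(\<R> j)"
    and nested: "\<And>i j. i \<le> j \<Longrightarrow> j + 2 < length ?U \<Longrightarrow> \<L> i \<subseteq> \<L> j \<and> \<R> j \<subseteq> \<R> i"
    using nested_separations[OF assms(3) U] by blast
  obtain col :: "'v \<Rightarrow> nat" where col: "\<forall>v. col v \<le> k" "\<forall>B\<in>\<B>. inj_on col B"
    using acyclic_family_colouring[OF assms(3,4)] by blast
  define E where "E = (\<lambda>i. Us i ! 0) ` I \<union> (\<lambda>i. Us i ! (length (Us i) - 1)) ` I"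
  \<comment> \<open>One more than the number of possible types: there are at most
    \<open>2 * n + 1 \<le> 3 * n\<close> counts of endpoints and \<open>(k + 1) ^ n\<close> tuples
    of colours.\<close>
  define M where "M = 3 * n * (k + 1) ^ n + 1"
  have n: "n \<ge> 1" using long(1) assms(1,2) by (metis One_nat_def Suc_leI card_gt_0_iff empty_iff le_trans)
  \<comment> \<open>The largest index used is \<open>2 * (M - 1) = 6 * n * (k + 1) ^ n\<close>, and
    the assumed length leaves room for it.\<close>
  have M: "2 * m + 2 < length ?U" if "m < M" for m
  proof -
    have "2 * m \<le> 6 * n * (k + 1) ^ n" using that unfolding M_def by simp
    also have "n \<le> n\<^sup>2" using n by (simp add: power2_eq_square)
    then have "6 * n * (k + 1) ^ n \<le> 8 * n\<^sup>2 * (k + 1) ^ n" by (intro mult_right_mono) auto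
    finally show ?thesis using long(2) by linarith
  qed
  \<comment> \<open>Only even indices are used: the long walk enters the right side of separation
    \<open>j\<close> at position \<open>Suc j\<close>, so two different even indices give a jump
    over at least two positions.\<close>
  define type where "type m = (card (E \<inter> \<Union>(\<L> (2 * m))),
      restrict (\<lambda>i. col (crossing (\<L> (2 * m)) (\<R> (2 * m)) (Us i))) I)" for m
  have finE: "finite E" using assms(1) by (simp add: E_def)
  have cardE: "card E \<le> 2 * n"
  proof -
    have "card E \<le> card I + card I"
      unfolding E_def using assms(1) by (meson add_mono card_Un_le card_image_le le_trans)
    then show ?thesis using assms(2) by simp
  qed
  let ?types = "{..2 * n} \<times> (I \<rightarrow>\<^sub>E {..k})"
  have fint: "finite ?types" using assms(1) by (intro finite_cartesian_product finite_PiE) auto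
  have "type ` {..<M} \<subseteq> ?types"
  proof -
    have "card (E \<inter> A) \<le> 2 * n" for A
      using card_mono[OF finE, of "E \<inter> A"] cardE by simp
    then show ?thesis using col(1) unfolding type_def by auto
  qed
  then have "card (type ` {..<M}) \<le> card ?types" using fint card_mono by blast
  also have "card ?types = (2 * n + 1) * (k + 1) ^ card I"
    using assms(1) by (simp add: card_cartesian_product card_PiE)
  also have "\<dots> \<le> (2 * n + 1) * (k + 1) ^ n"
    using assms(2) by (intro mult_left_mono power_increasing) auto
  also have "\<dots> \<le> 3 * n * (k + 1) ^ n" using n by (intro mult_right_mono) auto
  also have "\<dots> < card {..<M}" by (simp add: M_def)
  finally have "\<not> inj_on type {..<M}" by (rule pigeonhole)
  then obtain a b where ab: "a < b" "b < M" "type a = type b"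
    unfolding inj_on_def by (metis lessThan_iff linorder_neqE_nat)
  let ?a = "2 * a" and ?b = "2 * b"
  have a: "?a + 2 < length ?U" and b: "?b + 2 < length ?U" using M ab by auto
  have nest: "\<L> ?a \<subseteq> \<L> ?b" "\<R> ?b \<subseteq> \<R> ?a" using nested[of ?a ?b] b ab by auto
  note sa = separationD[OF sep[OF a]]
  \<comment> \<open>The bag \<open>T ?a\<close> has at most \<open>k + 1\<close> elements, and its
    element \<open>?U ! ?a\<close> is outside the separator.\<close>
  have "\<Union>(\<L> ?a) \<inter> \<Union>(\<R> ?a) \<subseteq> T ?a - {?U ! ?a}" using sa(6,7) drop[OF a] by blast
  moreover have "finite (T ?a)" "card (T ?a) \<le> Suc k" using assms(4) sa(1,4) by blast+
  ultimately have "card (\<Union>(\<L> ?a) \<inter> \<Union>(\<R> ?a)) \<le> k"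
    using drop[OF a] card_mono[of "T ?a - {?U ! ?a}" "\<Union>(\<L> ?a) \<inter> \<Union>(\<R> ?a)"]
    by (simp add: card_Diff_singleton)
  then obtain \<B>' where B': "acyclic_family \<B>'" "\<Union>\<B>' \<subseteq> \<Union>\<B>"
    "\<forall>B\<in>\<B>'. finite B \<and> card B \<le> Suc k" "\<L> ?a \<subseteq> \<B>'" "\<R> ?b \<subseteq> \<B>'"
    "\<forall>x\<in>\<Union>(\<L> ?a) \<inter> \<Union>(\<R> ?a). \<forall>y\<in>\<Union>(\<L> ?b) \<inter> \<Union>(\<R> ?b).
      col x = col y \<longrightarrow> (\<exists>B\<in>\<B>'. x \<in> B \<and> y \<in> B)"
    using cut_family[OF sep[OF a] sep[OF b] nest assms(4) _ col(2)] by blast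
  \<comment> \<open>The sets of endpoints on the left grow with the index, so equal cardinalities
    force equal sets; this is why recording a number is enough.\<close>
  have E: "x \<in> \<Union>(\<L> ?b) \<longrightarrow> x \<in> \<Union>(\<L> ?a)" if "x \<in> E" for x
  proof -
    have "E \<inter> \<Union>(\<L> ?a) \<subseteq> E \<inter> \<Union>(\<L> ?b)" using nest by blast
    moreover have "card (E \<inter> \<Union>(\<L> ?a)) = card (E \<inter> \<Union>(\<L> ?b))"
      using ab(3) by (simp add: type_def)
    ultimately have "E \<inter> \<Union>(\<L> ?a) = E \<inter> \<Union>(\<L> ?b)"
      using finE by (intro card_subset_eq) auto
    then show ?thesis using that by blast
  qed
  have "\<forall>i\<in>I. \<exists>p q. p \<le> q \<and> q < length (Us i) \<and> walk_in \<B>' (jump p q (Us i)) \<and>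
    (Us i ! 0 \<in> \<Union>(\<L> ?a) \<and> Us i ! (length (Us i) - 1) \<in> \<Union>(\<R> ?b) \<longrightarrow>
      p = first_in (\<Union>(\<R> ?a)) (Us i) \<and> q = first_in (\<Union>(\<R> ?b)) (Us i))"
  proof
    fix i assume i: "i \<in> I"
    have "snd (type a) i = snd (type b) i" using ab(3) by simp
    then have "col (crossing (\<L> ?a) (\<R> ?a) (Us i)) = col (crossing (\<L> ?b) (\<R> ?b) (Us i))"
      using i by (simp add: type_def)
    moreover have "Us i ! 0 \<in> E" "Us i ! (length (Us i) - 1) \<in> E" using i by (auto simp: E_def)
    ultimately show "\<exists>p q. p \<le> q \<and> q < length (Us i) \<and> walk_in \<B>' (jump p q (Us i)) \<and>
      (Us i ! 0 \<in> \<Union>(\<L> ?a) \<and> Us i ! (length (Us i) - 1) \<in> \<Union>(\<R> ?b) \<longrightarrow>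
        p = first_in (\<Union>(\<R> ?a)) (Us i) \<and> q = first_in (\<Union>(\<R> ?b)) (Us i))"
      using walks True i
      by (intro cut_walk[OF sep[OF a] sep[OF b] nest B'(4-6)] E) simp_all
  qed
  then obtain p q where pq: "\<And>i. i \<in> I \<Longrightarrow> p i \<le> q i \<and> q i < length (Us i) \<and>
      walk_in \<B>' (jump (p i) (q i) (Us i)) \<and>
      (Us i ! 0 \<in> \<Union>(\<L> ?a) \<and> Us i ! (length (Us i) - 1) \<in> \<Union>(\<R> ?b) \<longrightarrow>
      p i = first_in (\<Union>(\<R> ?a)) (Us i) \<and> q i = first_in (\<Union>(\<R> ?b)) (Us i))"
    by metis
  have "p i0 = Suc ?a" "q i0 = Suc ?b"
    using pq[OF long(1)] ends[OF a] ends[OF b] first[OF a] first[OF b] by auto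
  then have "p i0 + 2 \<le> q i0" using ab(1) by simp
  then show ?thesis using B'(1-3) pq long(1) by blast
qed

text \<open>Rounds of shortening are repeated, with the total length decreasing. The entries carry
  more than the vertex that \<open>v\<close> extracts, so the states of the runs survive the
  jumps.\<close>

lemma shorten_walks:
  fixes v :: "'b \<Rightarrow> 'v" and Ws :: "'i \<Rightarrow> 'b list"
  assumes "finite I" "card I \<le> n" "acyclic_family \<B>" "\<forall>B\<in>\<B>. finite B \<and> card B \<le> Suc k"
    and "\<forall>i\<in>I. walk_in \<B> (map v (Ws i)) \<and> 2 \<le> length (Ws i)"
  shows "\<exists>\<B>' Ws'. acyclic_family \<B>' \<and> \<Union>\<B>' \<subseteq> \<Union>\<B> \<and> (\<forall>B\<in>\<B>'. finite B \<and> card B \<le> Suc k) \<and>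
    (\<forall>i\<in>I. walk_in \<B>' (map v (Ws' i)) \<and> 2 \<le> length (Ws' i) \<and> subseq (Ws' i) (Ws i) \<and>
      hd (Ws' i) = hd (Ws i) \<and> last (Ws' i) = last (Ws i) \<and>
      length (Ws' i) \<le> 8 * n\<^sup>2 * (k + 1) ^ n + 2)"
  using assms(3-5)
proof (induction "\<Sum>i\<in>I. length (Ws i)" arbitrary: Ws \<B> rule: less_induct)
  case less
  show ?case
  proof (cases "\<forall>i\<in>I. length (Ws i) \<le> 8 * n\<^sup>2 * (k + 1) ^ n + 2")
    case True
    then show ?thesis using less.prems by (intro exI[of _ \<B>] exI[of _ Ws]) auto
  next
    case False
    then obtain i0 where i0: "i0 \<in> I" "length (map v (Ws i0)) > 8 * n\<^sup>2 * (k + 1) ^ n + 2" by auto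
    have walks: "\<forall>i\<in>I. walk_in \<B> (map v (Ws i)) \<and> map v (Ws i) \<noteq> []" using less.prems(3) by auto
    obtain \<B>' p q where red: "acyclic_family \<B>'" "\<Union>\<B>' \<subseteq> \<Union>\<B>" "\<forall>B\<in>\<B>'. finite B \<and> card B \<le> Suc k"
      and pq: "\<forall>i\<in>I. p i \<le> q i \<and> q i < length (map v (Ws i)) \<and>
          walk_in \<B>' (jump (p i) (q i) (map v (Ws i)))" "\<exists>i\<in>I. p i + 2 \<le> q i"
      using reduce_walks[OF assms(1,2) less.prems(1,2) walks i0] by blast
    define Vs where "Vs i = jump (p i) (q i) (Ws i)" for i
    have le: "p i \<le> q i" "q i < length (Ws i)" if "i \<in> I" for i using pq(1) that by auto
    have walk: "walk_in \<B>' (map v (Vs i))" if "i \<in> I" for i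
      using pq(1) that by (simp add: Vs_def jump_map)
    have two: "2 \<le> length (Vs i)" if "i \<in> I" for i
      unfolding Vs_def using le[OF that] less.prems(3) that by (intro two_le_length_jump) auto
    have "length (Vs i) \<le> length (Ws i)" if "i \<in> I" for i
      unfolding Vs_def using le[OF that] by (auto simp: length_jump)
    moreover obtain i1 where i1: "i1 \<in> I" "p i1 + 2 \<le> q i1" using pq(2) by blast
    have "length (Vs i1) < length (Ws i1)"
      unfolding Vs_def using le[OF i1(1)] i1(2) by (simp add: length_jump)
    ultimately have "(\<Sum>i\<in>I. length (Vs i)) < (\<Sum>i\<in>I. length (Ws i))"
      using i1(1) assms(1) by (intro sum_strict_mono_ex1) auto
    from less.hyps[OF this red(1,3)] walk two obtain \<B>'' Ws' where
      IH: "acyclic_family \<B>''" "\<Union>\<B>'' \<subseteq> \<Union>\<B>'" "\<forall>B\<in>\<B>''. finite B \<and> card B \<le> Suc k"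
      "\<And>i. i \<in> I \<Longrightarrow> walk_in \<B>'' (map v (Ws' i)) \<and> 2 \<le> length (Ws' i) \<and> subseq (Ws' i) (Vs i) \<and>
        hd (Ws' i) = hd (Vs i) \<and> last (Ws' i) = last (Vs i) \<and>
        length (Ws' i) \<le> 8 * n\<^sup>2 * (k + 1) ^ n + 2"
      by blast
    have Vs: "subseq (Vs i) (Ws i)" "hd (Vs i) = hd (Ws i)" "last (Vs i) = last (Ws i)" if "i \<in> I" for i
    proof -
      have "Ws i \<noteq> []" using less.prems(3) that by auto
      then show "subseq (Vs i) (Ws i)" "hd (Vs i) = hd (Ws i)" "last (Vs i) = last (Ws i)"
        unfolding Vs_def using le[OF that] by (simp_all add: subseq_jump hd_jump last_jump)
    qed
    have "walk_in \<B>'' (map v (Ws' i)) \<and> 2 \<le> length (Ws' i) \<and> subseq (Ws' i) (Ws i) \<and>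
        hd (Ws' i) = hd (Ws i) \<and> last (Ws' i) = last (Ws i) \<and>
        length (Ws' i) \<le> 8 * n\<^sup>2 * (k + 1) ^ n + 2" if "i \<in> I" for i
      using IH(4)[OF that] Vs[OF that] subseq_order.trans by metis
    then show ?thesis using IH(1-3) red(2) by (meson subset_trans)
  qed
qed


section \<open>From walks to refinements\<close>

lemma lpath_append: "lpath E u w v \<Longrightarrow> lpath E v w' z \<Longrightarrow> lpath E u (w @ w') z"
  by (induction rule: lpath.induct) (auto intro: lpath.intros)

lemma lpath_single_iff: "lpath E u [l] v \<longleftrightarrow> (u, l, v) \<in> E"
  by (auto elim: lpath.cases intro: lpath.intros)

lemma pm_edges_reverse: "(u, Pos a, v) \<in> pm_edges G \<Longrightarrow> (v, Neg a, u) \<in> pm_edges G"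
  by (auto simp: pm_edges_def)

lemma lang_letter_nfa: "w \<in> lang (letter_nfa l) \<Longrightarrow> w = [l]"
  by (auto simp: lang_def letter_nfa_def elim!: lpath.cases)

lemma lang_nfa_between: "lang (nfa_between A q q') = {w. lpath (delta A) q w q'}"
  by (auto simp: lang_def nfa_between_def)

lemma is_nfa_between: "is_nfa A \<Longrightarrow> q \<in> states A \<Longrightarrow> q' \<in> states A \<Longrightarrow> is_nfa (nfa_between A q q')"
  by (auto simp: is_nfa_def nfa_between_def)

text \<open>A pair consists of a state and a query variable. One word has to be read both by the
  automaton and along the database; concatenation makes the relation transitive, so any two
  positions of a run are linked once neighbours are.\<close>

definition linked ::
    "'l nfa \<Rightarrow> ('v \<times> 'l \<times> 'v) set \<Rightarrow> (nat \<Rightarrow> 'v) \<Rightarrow> nat \<times> nat \<Rightarrow> nat \<times> nat \<Rightarrow> bool" where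
  "linked A E g p p' \<longleftrightarrow>
     (\<exists>w. lpath (delta A) (fst p) w (fst p') \<and> lpath E (g (snd p)) w (g (snd p')))"

lemma transp_linked: "transp (linked A E g)"
  unfolding linked_def by (rule transpI) (blast intro: lpath_append)

text \<open>For an inverse letter the refined atom points backwards and carries the positive letter;
  the reversed edge in \<open>pm_edges\<close> restores the inverse letter.\<close>

lemma refine_step_linked:
  assumes "refine_step A (fst p) (fst p') (snd p) (snd p') (x, B, y)"
    and "w \<in> lang B" "lpath (pm_edges G) (g x) w (g y)"
  shows "linked A (pm_edges G) g p p'"
proof -
  consider (stay) "x = snd p" "B = nfa_between A (fst p) (fst p')" "y = snd p'"
    | (pos) a where "lpath (delta A) (fst p) [Pos a] (fst p')" "x = snd p" "y = snd p'" "B = letter_nfa (Pos a)"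
    | (neg) a where "lpath (delta A) (fst p) [Neg a] (fst p')" "x = snd p'" "y = snd p" "B = letter_nfa (Pos a)"
    using assms(1) unfolding refine_step_def lang_nfa_between by auto
  then show ?thesis
  proof cases
    case stay
    then show ?thesis using assms(2,3) unfolding linked_def by (auto simp: lang_nfa_between)
  next
    case pos
    then have "w = [Pos a]" using assms(2) by (simp add: lang_letter_nfa)
    then show ?thesis using pos assms(3) unfolding linked_def by blast
  next
    case neg
    then have "w = [Pos a]" using assms(2) by (simp add: lang_letter_nfa)
    then have "lpath (pm_edges G) (g (snd p)) [Neg a] (g (snd p'))"
      using neg assms(3) pm_edges_reverse by (simp add: lpath_single_iff)
    then show ?thesis using neg unfolding linked_def by blast
  qed
qed

lemma refine_step_ends:
  "refine_step A q q' t t' (x, B, y) \<Longrightarrow> (x = t \<and> y = t') \<or> (x = t' \<and> y = t)"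
  by (auto simp: refine_step_def)

text \<open>States and variables are paired in one list, so that a single jump shortens the run and
  the path of variables together.\<close>

lemma path_refinement_run:
  assumes "path_refinement m (x, A, y) ts es"
  obtains W where "map snd W = x # ts @ [y]" "fst ` set W \<subseteq> states A"
    "fst (hd W) \<in> initial A" "fst (last W) \<in> final A"
    "\<And>i. Suc i < length W \<Longrightarrow> \<exists>e\<in>set es.
      refine_step A (fst (W ! i)) (fst (W ! Suc i)) (snd (W ! i)) (snd (W ! Suc i)) e"
proof -
  obtain qs where len: "length es = Suc (length ts)" and qs: "length qs = Suc (length es)"
    "set qs \<subseteq> states A" "hd qs \<in> initial A" "last qs \<in> final A"
    "\<forall>i < length es. refine_step A (qs ! i) (qs ! Suc i)
       ((x # ts @ [y]) ! i) ((x # ts @ [y]) ! Suc i) (es ! i)"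
    using assms unfolding path_refinement_def by auto
  let ?vs = "x # ts @ [y]"
  have len': "length qs = length ?vs" using len qs(1) by simp
  have W: "map fst (zip qs ?vs) = qs" "map snd (zip qs ?vs) = ?vs" using len' by simp_all
  have "zip qs ?vs \<noteq> []" using len' by (cases qs) auto
  then have "fst (hd (zip qs ?vs)) = hd qs" "fst (last (zip qs ?vs)) = last qs"
    using W(1) by (metis hd_map, metis last_map)
  moreover have "fst ` set (zip qs ?vs) = set qs" using W(1) by (metis set_map)
  moreover have "\<exists>e\<in>set es. refine_step A (fst (zip qs ?vs ! i)) (fst (zip qs ?vs ! Suc i))
      (snd (zip qs ?vs ! i)) (snd (zip qs ?vs ! Suc i)) e" if "Suc i < length (zip qs ?vs)" for i
  proof
    have "i < length es" using that len' qs(1) by simp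
    then show "es ! i \<in> set es" by simp
    have "zip qs ?vs ! i = (qs ! i, ?vs ! i)" "zip qs ?vs ! Suc i = (qs ! Suc i, ?vs ! Suc i)"
      using that len' by (simp_all only: nth_zip length_zip min.idem Suc_lessD)
    then show "refine_step A (fst (zip qs ?vs ! i)) (fst (zip qs ?vs ! Suc i))
      (snd (zip qs ?vs ! i)) (snd (zip qs ?vs ! Suc i)) (es ! i)"
      using qs(5) \<open>i < length es\<close> by simp
  qed
  ultimately show ?thesis using that[of "zip qs ?vs"] W(2) qs by simp
qed

text \<open>Single letters of the original refinement are weakened to the automaton between the same
  states, so skipped and unskipped steps yield atoms of one shape.\<close>

definition run_atoms :: "'a signed nfa \<Rightarrow> (nat \<times> nat) list \<Rightarrow> 'a atom list" where
  "run_atoms A W = map (\<lambda>i. (snd (W ! i), nfa_between A (fst (W ! i)) (fst (W ! Suc i)), snd (W ! Suc i)))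
     [0..<length W - 1]"

lemma path_refinement_run_atoms:
  assumes "map snd W = x # ts @ [y]" "fst ` set W \<subseteq> states A"
    "fst (hd W) \<in> initial A" "fst (last W) \<in> final A" "length W \<le> Suc m"
  shows "path_refinement m (x, A, y) ts (run_atoms A W)"
proof -
  have len: "length W = Suc (Suc (length ts))" using assms(1) by (metis length_map length_Cons length_append_singleton)
  then have "W \<noteq> []" by auto
  have nth: "(x # ts @ [y]) ! i = snd (W ! i)" if "i < length W" for i
    using that nth_map[of i W snd] assms(1) by simp
  have "\<exists>qs. length qs = Suc (length (run_atoms A W)) \<and> set qs \<subseteq> states A \<and>
      hd qs \<in> initial A \<and> last qs \<in> final A \<and>
      (\<forall>i < length (run_atoms A W). refine_step A (qs ! i) (qs ! Suc i)
        ((x # ts @ [y]) ! i) ((x # ts @ [y]) ! Suc i) (run_atoms A W ! i))"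
  proof (intro exI[of _ "map fst W"] conjI allI impI)
    show "set (map fst W) \<subseteq> states A" using assms(2) by simp
    show "hd (map fst W) \<in> initial A" "last (map fst W) \<in> final A"
      using assms(3,4) \<open>W \<noteq> []\<close> by (simp_all add: hd_map last_map)
    show "length (map fst W) = Suc (length (run_atoms A W))" using len by (simp add: run_atoms_def)
    fix i assume "i < length (run_atoms A W)"
    then have i: "i < length W - 1" by (simp add: run_atoms_def)
    then have "run_atoms A W ! i =
        (snd (W ! i), nfa_between A (fst (W ! i)) (fst (W ! Suc i)), snd (W ! Suc i))"
      by (simp add: run_atoms_def)
    then show "refine_step A (map fst W ! i) (map fst W ! Suc i)
        ((x # ts @ [y]) ! i) ((x # ts @ [y]) ! Suc i) (run_atoms A W ! i)"
      using i nth[of i] nth[of "Suc i"] unfolding refine_step_def by simp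
  qed
  moreover have "length (run_atoms A W) = Suc (length ts)" using len by (simp add: run_atoms_def)
  ultimately show ?thesis unfolding path_refinement_def using len assms(5) by simp
qed

lemma subseq_inner:
  assumes "subseq ws' ws" "hd ws' = hd ws" "last ws' = last ws" "2 \<le> length ws'"
    and "map g ws = a # ts @ [b]"
  obtains ts' where "map g ws' = a # ts' @ [b]" "subseq ts' ts"
proof -
  have ne: "ws' \<noteq> []" "ws \<noteq> []" using assms(4,5) by auto
  obtain c us where "ws' = c # us" using ne by (cases ws') auto
  moreover have "us \<noteq> []" using calculation assms(4) by auto
  then obtain vs d where "us = vs @ [d]" by (metis rev_exhaust)
  ultimately have ws': "ws' = c # vs @ [d]" by simp
  have "g c = a" using assms(2,5) ne(2) ws' by (metis hd_map list.sel(1))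
  moreover have "last (map g ws) = b" using assms(5) by simp
  then have "g d = b" using assms(3) ne(2) ws' by (simp add: last_map)
  ultimately have *: "map g ws' = a # map g vs @ [b]" using ws' by simp
  have "subseq (map g ws') (map g ws)" using assms(1) by (rule subseq_map)
  then have "subseq (map g vs) ts" unfolding * assms(5) by simp
  then show ?thesis by (rule that[OF *])
qed

section \<open>Subsequences, and refinements in terms of projections\<close>

lemma subseq_concat: "list_all2 subseq xss yss \<Longrightarrow> subseq (concat xss) (concat yss)"
  by (induction rule: list_all2_induct) (auto intro: list_emb_append_mono)

lemma subseq_sorted_wrt: "subseq xs ys \<Longrightarrow> sorted_wrt P ys \<Longrightarrow> sorted_wrt P xs"
  by (induction rule: list_emb.induct) (auto dest: list_emb_set)

lemma subseq_set_subset: "subseq xs ys \<Longrightarrow> set xs \<subseteq> set ys"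
  by (auto dest: list_emb_set)

lemma Ref_le_iff:
  "\<rho> \<in> Ref_le m \<gamma> \<longleftrightarrow> (\<exists>rs h. list_all2 (\<lambda>e r. r \<in> atom_refinements m e) (atoms \<gamma>) rs \<and>
     distinct (concat (map fst rs)) \<and> set (concat (map fst rs)) \<inter> vars \<gamma> = {} \<and>
     (\<forall>x \<in> vars \<gamma> \<union> set (concat (map fst rs)). \<forall>y \<in> vars \<gamma> \<union> set (concat (map fst rs)).
        h x = h y \<longleftrightarrow>
          (x, y) \<in> (\<Union>(set (map (snd \<circ> snd) rs)) \<union> (\<Union>(set (map (snd \<circ> snd) rs)))\<inverse>)\<^sup>*) \<and>
     \<rho> = \<lparr>outs = map h (outs \<gamma>), vars = h ` (vars \<gamma> \<union> set (concat (map fst rs))),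
          atoms = map (\<lambda>(x, A, y). (h x, A, h y)) (concat (map (fst \<circ> snd) rs))\<rparr>)"
proof -
  have 1: "(\<lambda>(ts, es, eqs). ts) = fst" for ts :: "nat list"
    by (auto simp: fun_eq_iff)
  have 2: "(\<lambda>(ts, es, eqs). es) = fst \<circ> snd"
    by (auto simp: fun_eq_iff)
  have 3: "(\<Union>(ts, es, eqs) \<in> S. eqs) = \<Union>((snd \<circ> snd) ` S)" for S :: "('x \<times> 'y \<times> 'z set) set"
    by auto
  show ?thesis
    unfolding Ref_le_def Let_def 1 2 3 set_map by simp
qed

text \<open>The new query is the image of the shortened refinement under the old map
  \<open>f\<close>. It is thus a strong onto image by construction, and truth under \<open>g\<close>
  and the tree-width remain to be checked.\<close>

lemma App_star_shorten:
  assumes "is_c2rpq \<gamma>" "\<alpha> \<in> App_star (Tw k) \<gamma>" "satisfies G us \<alpha>"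
  shows "\<exists>\<alpha>' \<in> App_star_le (Tw k) (8 * (num_atoms \<gamma>)\<^sup>2 * (k + 1) ^ num_atoms \<gamma> + 1) \<gamma>. satisfies G us \<alpha>'"
proof -
  define n where "n = num_atoms \<gamma>"
  \<comment> \<open>A walk with at most \<open>l + 1\<close> positions yields at most
    \<open>l\<close> atoms.\<close>
  define l where "l = 8 * n\<^sup>2 * (k + 1) ^ n + 1"
  let ?E = "pm_edges G"
  obtain m \<rho> f where \<rho>: "\<rho> \<in> Ref_le m \<gamma>" and hom: "query_hom f \<rho> \<alpha>" and \<alpha>: "\<alpha> \<in> Tw k"
    using assms(2) unfolding App_star_def Ref_def strong_onto_hom_def by blast
  have c2: "is_c2rpq \<alpha>" "treewidth \<alpha> \<le> k" using \<alpha> unfolding Tw_def by auto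
  have fin: "finite (vars \<alpha>)" and ends: "\<forall>(x, A, y)\<in>set (atoms \<alpha>). x \<in> vars \<alpha> \<and> y \<in> vars \<alpha>"
    using c2(1) unfolding is_c2rpq_def by auto
  obtain \<B> where B: "acyclic_family \<B>" "\<Union>\<B> = vars \<alpha>" "\<forall>B\<in>\<B>. card B \<le> Suc k"
    "\<forall>(x, A, y)\<in>set (atoms \<alpha>). \<exists>B\<in>\<B>. x \<in> B \<and> y \<in> B"
    using treewidth_le_iff[OF fin ends, of k] c2(2) by blast
  have finB: "\<forall>B\<in>\<B>. finite B \<and> card B \<le> Suc k"
    using B(2,3) fin by (metis Union_upper finite_subset)
  obtain g where g: "g ` vars \<alpha> \<subseteq> nodes G" "map g (outs \<alpha>) = us"
    "\<forall>(x, L, y)\<in>lang_atoms \<alpha>. \<exists>w\<in>L. lpath ?E (g x) w (g y)"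
    using assms(3) unfolding satisfies_def by blast
  obtain rs h where rs: "list_all2 (\<lambda>e r. r \<in> atom_refinements m e) (atoms \<gamma>) rs"
    and fresh: "distinct (concat (map fst rs))" "set (concat (map fst rs)) \<inter> vars \<gamma> = {}"
    and h: "\<forall>x \<in> vars \<gamma> \<union> set (concat (map fst rs)). \<forall>y \<in> vars \<gamma> \<union> set (concat (map fst rs)).
        h x = h y \<longleftrightarrow>
          (x, y) \<in> (\<Union>(set (map (snd \<circ> snd) rs)) \<union> (\<Union>(set (map (snd \<circ> snd) rs)))\<inverse>)\<^sup>*"
    and \<rho>_eq: "\<rho> = \<lparr>outs = map h (outs \<gamma>), vars = h ` (vars \<gamma> \<union> set (concat (map fst rs))),
          atoms = map (\<lambda>(x, A, y). (h x, A, h y)) (concat (map (fst \<circ> snd) rs))\<rparr>"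
    using \<rho>[unfolded Ref_le_iff] by blast
  have len: "length rs = n" "length (atoms \<gamma>) = n"
    using list_all2_lengthD[OF rs] unfolding n_def num_atoms_def by simp_all
  define \<phi> where "\<phi> = (\<lambda>t. f (h t))"
  define src where "src i = fst (atoms \<gamma> ! i)" for i
  define aut where "aut i = fst (snd (atoms \<gamma> ! i))" for i
  define tgt where "tgt i = snd (snd (atoms \<gamma> ! i))" for i
  have atom: "atoms \<gamma> ! i = (src i, aut i, tgt i)" for i by (simp add: src_def aut_def tgt_def)
  \<comment> \<open>The atoms refined to a path. Those refined to an equality have no inner
    variables and are kept as they are.\<close>
  define I where "I = {i. i < n \<and> snd (snd (rs ! i)) = {}}"
  have "finite I" "card I \<le> n"
    using card_mono[of "{..<n}" I] unfolding I_def by auto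
  have ref: "rs ! i \<in> atom_refinements m (src i, aut i, tgt i)" if "i < n" for i
    using list_all2_nthD[OF rs] that len atom by metis
  have run: "path_refinement m (src i, aut i, tgt i) (fst (rs ! i)) (fst (snd (rs ! i)))" if "i \<in> I" for i
    using ref[of i] that unfolding I_def atom_refinements_def by (auto split: if_splits)
  have eq: "rs ! i = ([], [], {(src i, tgt i)}) \<and> [] \<in> lang (aut i)" if "i < n" "i \<notin> I" for i
    using ref[of i] that unfolding I_def atom_refinements_def by (auto split: if_splits)
  have "\<forall>i. \<exists>W. i \<in> I \<longrightarrow> map snd W = src i # fst (rs ! i) @ [tgt i] \<and> fst ` set W \<subseteq> states (aut i) \<and>
    fst (hd W) \<in> initial (aut i) \<and> fst (last W) \<in> final (aut i) \<and>
    (\<forall>j. Suc j < length W \<longrightarrow> (\<exists>e\<in>set (fst (snd (rs ! i))).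
      refine_step (aut i) (fst (W ! j)) (fst (W ! Suc j)) (snd (W ! j)) (snd (W ! Suc j)) e))"
    using path_refinement_run[OF run] by metis
  then obtain W where W: "\<And>i. i \<in> I \<Longrightarrow> map snd (W i) = src i # fst (rs ! i) @ [tgt i]"
    "\<And>i. i \<in> I \<Longrightarrow> fst ` set (W i) \<subseteq> states (aut i)"
    "\<And>i. i \<in> I \<Longrightarrow> fst (hd (W i)) \<in> initial (aut i)" "\<And>i. i \<in> I \<Longrightarrow> fst (last (W i)) \<in> final (aut i)"
    "\<And>i j. i \<in> I \<Longrightarrow> Suc j < length (W i) \<Longrightarrow> \<exists>e\<in>set (fst (snd (rs ! i))).
      refine_step (aut i) (fst (W i ! j)) (fst (W i ! Suc j)) (snd (W i ! j)) (snd (W i ! Suc j)) e"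
    by metis
  have step: "(\<exists>B\<in>\<B>. \<phi> (snd (W i ! j)) \<in> B \<and> \<phi> (snd (W i ! Suc j)) \<in> B) \<and>
      linked (aut i) ?E (\<lambda>t. g (\<phi> t)) (W i ! j) (W i ! Suc j)"
    if ij: "i \<in> I" "Suc j < length (W i)" for i j
  proof -
    obtain a C b where e: "(a, C, b) \<in> set (fst (snd (rs ! i)))" and
      step: "refine_step (aut i) (fst (W i ! j)) (fst (W i ! Suc j)) (snd (W i ! j)) (snd (W i ! Suc j)) (a, C, b)"
      using W(5)[OF ij] by (metis prod_cases3)
    have "rs ! i \<in> set rs" using ij(1) len I_def by auto
    then have "(a, C, b) \<in> set (concat (map (fst \<circ> snd) rs))" using e by auto
    then have "(h a, C, h b) \<in> set (atoms \<rho>)" unfolding \<rho>_eq by force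
    then have "(h a, lang C, h b) \<in> lang_atoms \<rho>" unfolding lang_atoms_def by force
    then have ab: "(\<phi> a, lang C, \<phi> b) \<in> lang_atoms \<alpha>" using hom unfolding query_hom_def \<phi>_def by fast
    then obtain C' where "(\<phi> a, C', \<phi> b) \<in> set (atoms \<alpha>)" unfolding lang_atoms_def by force
    then obtain B where "B \<in> \<B>" "\<phi> a \<in> B" "\<phi> b \<in> B" using B(4) by fast
    then have "\<exists>B\<in>\<B>. \<phi> (snd (W i ! j)) \<in> B \<and> \<phi> (snd (W i ! Suc j)) \<in> B"
      using refine_step_ends[OF step] by auto
    moreover obtain w where "w \<in> lang C" "lpath ?E (g (\<phi> a)) w (g (\<phi> b))" using g(3) ab by fast
    then have "linked (aut i) ?E (\<lambda>t. g (\<phi> t)) (W i ! j) (W i ! Suc j)"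
      using refine_step_linked[OF step, of w G "\<lambda>t. g (\<phi> t)"] by simp
    ultimately show ?thesis by blast
  qed
  have "walk_in \<B> (map (\<lambda>p. \<phi> (snd p)) (W i)) \<and> 2 \<le> length (W i)" if "i \<in> I" for i
  proof
    show "walk_in \<B> (map (\<lambda>p. \<phi> (snd p)) (W i))" using step[OF that] by (simp add: walk_in_def)
    show "2 \<le> length (W i)" using arg_cong[OF W(1)[OF that], of length] by simp
  qed
  then obtain \<B>' W' where B': "acyclic_family \<B>'" "\<Union>\<B>' \<subseteq> \<Union>\<B>" "\<forall>B\<in>\<B>'. finite B \<and> card B \<le> Suc k"
    and W'_I: "\<forall>i\<in>I. walk_in \<B>' (map (\<lambda>p. \<phi> (snd p)) (W' i)) \<and> 2 \<le> length (W' i) \<and>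
      subseq (W' i) (W i) \<and> hd (W' i) = hd (W i) \<and> last (W' i) = last (W i) \<and>
      length (W' i) \<le> 8 * n\<^sup>2 * (k + 1) ^ n + 2"
    using shorten_walks[OF \<open>finite I\<close> \<open>card I \<le> n\<close> B(1) finB, of "\<lambda>p. \<phi> (snd p)" W] by blast
  have W': "walk_in \<B>' (map (\<lambda>p. \<phi> (snd p)) (W' i)) \<and> 2 \<le> length (W' i) \<and>
      subseq (W' i) (W i) \<and> hd (W' i) = hd (W i) \<and> last (W' i) = last (W i) \<and> length (W' i) \<le> Suc l"
    if "i \<in> I" for i
    using bspec[OF W'_I that] unfolding l_def by simp
  have "\<exists>ts. map snd (W' i) = src i # ts @ [tgt i] \<and> subseq ts (fst (rs ! i))" if i: "i \<in> I" for i
  proof -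
    have w: "subseq (W' i) (W i)" "hd (W' i) = hd (W i)" "last (W' i) = last (W i)" "2 \<le> length (W' i)"
      using W'[OF i] by simp_all
    show ?thesis by (rule subseq_inner[OF w W(1)[OF i]]) (intro exI conjI)
  qed
  then obtain ts where ts: "\<And>i. i \<in> I \<Longrightarrow> map snd (W' i) = src i # ts i @ [tgt i]"
    "\<And>i. i \<in> I \<Longrightarrow> subseq (ts i) (fst (rs ! i))" by metis
  define r' where "r' i = (if i \<in> I then (ts i, run_atoms (aut i) (W' i), {}) else rs ! i)" for i
  define rs' where "rs' = map r' [0..<n]"
  have states: "fst ` set (W' i) \<subseteq> states (aut i)" if "i \<in> I" for i
    using subseq_set_subset[of "W' i" "W i"] W'[OF that] W(2)[OF that] by blast
  have "path_refinement l (src i, aut i, tgt i) (ts i) (run_atoms (aut i) (W' i))" if "i \<in> I" for i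
    using ts(1)[OF that] states[OF that] W(3,4)[OF that] W'[OF that]
    by (intro path_refinement_run_atoms) auto
  then have ref': "r' i \<in> atom_refinements l (src i, aut i, tgt i)" if "i < n" for i
    using eq[of i] that unfolding r'_def atom_refinements_def by auto
  have rs'_ref: "list_all2 (\<lambda>e r. r \<in> atom_refinements l e) (atoms \<gamma>) rs'"
    using ref' len atom unfolding rs'_def list_all2_conv_all_nth by simp
  have rs_map: "rs = map (\<lambda>i. rs ! i) [0..<n]" using len(1) map_nth by metis
  \<comment> \<open>The equality atoms are the same as before, so \<open>h\<close> still names the
    classes of variables, now on the smaller set \<open>V\<close>.\<close>
  have eqs: "map (snd \<circ> snd) rs' = map (snd \<circ> snd) rs"
    by (subst rs_map) (auto simp: rs'_def r'_def I_def)
  have "list_all2 subseq (map fst rs') (map fst rs)"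
    by (subst rs_map) (auto simp: rs'_def r'_def list_all2_conv_all_nth ts(2))
  then have sub: "subseq (concat (map fst rs')) (concat (map fst rs))" by (rule subseq_concat)
  define V where "V = vars \<gamma> \<union> set (concat (map fst rs'))"
  have VV: "V \<subseteq> vars \<gamma> \<union> set (concat (map fst rs))"
    using subseq_set_subset[OF sub] unfolding V_def by blast
  have fresh': "distinct (concat (map fst rs'))" "set (concat (map fst rs')) \<inter> vars \<gamma> = {}"
    using subseqs_distinctD[OF _ fresh(1)] sub fresh(2) subseq_set_subset[OF sub]
    by (simp only: in_set_subseqs, blast)
  define es where "es = concat (map (fst \<circ> snd) rs')"
  define \<rho>' where "\<rho>' = \<lparr>outs = map h (outs \<gamma>), vars = h ` V, atoms = map (\<lambda>(x, A, y). (h x, A, h y)) es\<rparr>"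
  \<comment> \<open>All variables of \<open>\<alpha>\<close> are kept, including those no longer
    visited by any walk; outputs and the valuation \<open>g\<close> therefore carry over.\<close>
  define \<alpha>' where "\<alpha>' = \<lparr>outs = outs \<alpha>, vars = vars \<alpha>, atoms = map (\<lambda>(x, A, y). (f x, A, f y)) (atoms \<rho>')\<rparr>"
  have "\<rho>' \<in> Ref_le l \<gamma>"
  proof -
    have "\<forall>x\<in>V. \<forall>y\<in>V. h x = h y \<longleftrightarrow>
        (x, y) \<in> (\<Union>(set (map (snd \<circ> snd) rs')) \<union> (\<Union>(set (map (snd \<circ> snd) rs')))\<inverse>)\<^sup>*"
      unfolding eqs using h VV by (meson subsetD)
    then show ?thesis
      unfolding Ref_le_iff using rs'_ref fresh' \<rho>'_def[unfolded V_def es_def] unfolding V_def by blast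
  qed
  have fh: "\<phi> t \<in> vars \<alpha>" if "t \<in> V" for t
  proof -
    have "f ` vars \<rho> \<subseteq> vars \<alpha>" using hom unfolding query_hom_def by blast
    moreover have "h t \<in> vars \<rho>" using that VV unfolding \<rho>_eq by (simp only: query.select_convs) blast
    ultimately show ?thesis unfolding \<phi>_def by blast
  qed
  have outs: "map f (map h (outs \<gamma>)) = outs \<alpha>" using hom unfolding query_hom_def \<rho>_eq by simp
  have image: "lang_atoms \<alpha>' = (\<lambda>(x, L, y). (f x, L, f y)) ` lang_atoms \<rho>'"
    unfolding lang_atoms_def \<alpha>'_def by (simp add: image_image case_prod_beta')
  have "\<forall>(x, L, y)\<in>lang_atoms \<rho>'. (f x, L, f y) \<in> lang_atoms \<alpha>'"
    unfolding image by (auto intro!: rev_image_eqI)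
  moreover have "\<forall>e\<in>lang_atoms \<alpha>'. \<exists>(x, L, y)\<in>lang_atoms \<rho>'. e = (f x, L, f y)"
    unfolding image by auto
  moreover have "f ` vars \<rho>' \<subseteq> vars \<alpha>'" "map f (outs \<rho>') = outs \<alpha>'"
    using fh outs unfolding \<alpha>'_def \<rho>'_def \<phi>_def by auto
  ultimately have "strong_onto_hom f \<rho>' \<alpha>'"
    unfolding strong_onto_hom_def query_hom_def by blast
  have new: "\<exists>i j. i \<in> I \<and> Suc j < length (W' i) \<and> x = snd (W' i ! j) \<and> y = snd (W' i ! Suc j) \<and>
      C = nfa_between (aut i) (fst (W' i ! j)) (fst (W' i ! Suc j))"
    if xy: "(x, C, y) \<in> set es" for x C y
  proof -
    obtain i where i: "i < n" "(x, C, y) \<in> set (fst (snd (r' i)))"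
      using xy unfolding es_def rs'_def by auto
    then have "i \<in> I" using eq[of i] unfolding r'_def by (cases "i \<in> I") auto
    then have "(x, C, y) \<in> set (run_atoms (aut i) (W' i))" using i(2) unfolding r'_def by simp
    then obtain j where "j < length (W' i) - 1" "x = snd (W' i ! j)" "y = snd (W' i ! Suc j)"
      "C = nfa_between (aut i) (fst (W' i ! j)) (fst (W' i ! Suc j))"
      unfolding run_atoms_def by auto
    then show ?thesis using \<open>i \<in> I\<close> by (intro exI[of _ i] exI[of _ j]) auto
  qed
  have new_V: "snd (W' i ! j) \<in> V" if "i \<in> I" "j < length (W' i)" for i j
  proof -
    have i: "i < n" using that(1) unfolding I_def by simp
    have "snd (W' i ! j) \<in> set (map snd (W' i))" using that(2) by simp
    then have "snd (W' i ! j) = src i \<or> snd (W' i ! j) = tgt i \<or> snd (W' i ! j) \<in> set (ts i)"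
      unfolding ts(1)[OF that(1)] by auto
    moreover have "src i \<in> vars \<gamma>" "tgt i \<in> vars \<gamma>"
      using assms(1) nth_mem[of i "atoms \<gamma>"] i len(2) unfolding is_c2rpq_def atom by auto
    moreover have "set (ts i) \<subseteq> set (concat (map fst rs'))"
      using i that(1) unfolding rs'_def by (auto simp: r'_def)
    ultimately show ?thesis unfolding V_def by (metis UnI1 UnI2 subsetD)
  qed
  have atoms': "atoms \<alpha>' = map (\<lambda>(x, A, y). (\<phi> x, A, \<phi> y)) es"
    unfolding \<alpha>'_def \<rho>'_def \<phi>_def by auto
  have vars': "vars \<alpha>' = vars \<alpha>" "outs \<alpha>' = outs \<alpha>" by (simp_all add: \<alpha>'_def)
  have atom': "a \<in> vars \<alpha> \<and> b \<in> vars \<alpha> \<and> is_nfa C \<and> (\<exists>B\<in>\<B>'. a \<in> B \<and> b \<in> B) \<and>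
      (\<exists>w\<in>lang C. lpath ?E (g a) w (g b))"
    if abC: "(a, C, b) \<in> set (atoms \<alpha>')" for a C b
  proof -
    obtain x y where xy: "(x, C, y) \<in> set es" "a = \<phi> x" "b = \<phi> y" using abC unfolding atoms' by auto
    obtain i j where ij: "i \<in> I" "Suc j < length (W' i)" "x = snd (W' i ! j)" "y = snd (W' i ! Suc j)"
      "C = nfa_between (aut i) (fst (W' i ! j)) (fst (W' i ! Suc j))" using new[OF xy(1)] by blast
    have "x \<in> V" "y \<in> V" using new_V[OF ij(1)] ij by auto
    then have "a \<in> vars \<alpha>" "b \<in> vars \<alpha>" using fh xy by auto
    moreover have "is_nfa (aut i)"
      using assms(1) nth_mem[of i "atoms \<gamma>"] ij(1) len(2) unfolding is_c2rpq_def atom I_def by auto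
    then have "is_nfa C"
      using states[OF ij(1)] ij(2) unfolding ij(5) by (intro is_nfa_between) auto
    moreover have "\<exists>B\<in>\<B>'. a \<in> B \<and> b \<in> B"
      using W'[OF ij(1)] ij(2) unfolding walk_in_def xy(2,3) ij(3,4) by simp
    \<comment> \<open>Transitivity extends the link from neighbours to all pairs of positions, and
      in this form it passes to the subsequence \<open>W' i\<close>.\<close>
    moreover have "sorted_wrt (linked (aut i) ?E (\<lambda>t. g (\<phi> t))) (W i)"
      using step[OF ij(1)] by (simp add: sorted_wrt_iff_nth_Suc_transp[OF transp_linked])
    then have "sorted_wrt (linked (aut i) ?E (\<lambda>t. g (\<phi> t))) (W' i)"
      using W'[OF ij(1)] subseq_sorted_wrt by blast
    then have "linked (aut i) ?E (\<lambda>t. g (\<phi> t)) (W' i ! j) (W' i ! Suc j)"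
      using ij(2) by (simp add: sorted_wrt_iff_nth_Suc_transp[OF transp_linked])
    then have "\<exists>w\<in>lang C. lpath ?E (g a) w (g b)"
      unfolding linked_def ij(5) lang_nfa_between xy(2,3) ij(3,4) by blast
    ultimately show ?thesis by blast
  qed
  have "is_c2rpq \<alpha>'"
    unfolding is_c2rpq_def vars' using c2(1) atom' unfolding is_c2rpq_def by auto
  moreover have "treewidth \<alpha>' \<le> k"
  proof -
    obtain \<B>'' where B'': "acyclic_family \<B>''" "\<Union>\<B>'' = vars \<alpha>" "\<B>' \<subseteq> \<B>''"
      "\<forall>B\<in>\<B>''. finite B \<and> card B \<le> Suc k"
      using acyclic_family_cover[OF fin B'(1) B'(2)[unfolded B(2)] B'(3)] by blast
    have fin': "finite (vars \<alpha>')" using fin vars' by simp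
    have ends': "\<forall>(x, A, y)\<in>set (atoms \<alpha>'). x \<in> vars \<alpha>' \<and> y \<in> vars \<alpha>'"
      using atom' vars' by auto
    have "\<forall>(x, A, y)\<in>set (atoms \<alpha>'). \<exists>B\<in>\<B>''. x \<in> B \<and> y \<in> B" using atom' B''(3) by blast
    then show ?thesis unfolding treewidth_le_iff[OF fin' ends'] using B'' vars'(1) by auto
  qed
  ultimately have "\<alpha>' \<in> Tw k" unfolding Tw_def by simp
  then have "\<alpha>' \<in> App_star_le (Tw k) l \<gamma>"
    unfolding App_star_le_def using \<open>\<rho>' \<in> Ref_le l \<gamma>\<close> \<open>strong_onto_hom f \<rho>' \<alpha>'\<close> by blast
  moreover have "satisfies G us \<alpha>'"
    unfolding satisfies_def lang_atoms_def vars'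
    using g(1,2) atom' by (intro exI[of _ g]) auto
  ultimately show ?thesis unfolding l_def n_def by blast
qed

section \<open>The explicit bound, its order of growth, and the equivalence\<close>

theorem lemma3p8:
  shows "\<exists>l :: nat \<Rightarrow> nat \<Rightarrow> nat.
    (\<lambda>(k, n). real (l k n)) \<in>
      \<Theta>[principal ({2..} \<times> {1..})](\<lambda>(k, n). real n ^ 2 * (real k + 1) ^ n) \<and>
    (\<forall>k \<ge> 2. \<forall>\<gamma> :: 'a::finite query. is_c2rpq \<gamma> \<longrightarrow>
      equivalent_unions (App_star (Tw k) \<gamma>) (App_star_le (Tw k) (l k (num_atoms \<gamma>)) \<gamma>))"
proof (intro exI conjI allI impI)
  let ?l = "\<lambda>k n :: nat. 8 * n\<^sup>2 * (k + 1) ^ n + 1"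
  \<comment> \<open>For \<open>n \<ge> 1\<close> the main term is at least one and absorbs the
    summand \<open>1\<close>, which turns the factor \<open>8\<close> into \<open>9\<close>.\<close>
  have bounds: "real n ^ 2 * (real k + 1) ^ n \<le> real (?l k n) \<and>
      real (?l k n) \<le> 9 * (real n ^ 2 * (real k + 1) ^ n)" if "1 \<le> n" for k n
  proof -
    have "real (?l k n) = 8 * (real n ^ 2 * (real k + 1) ^ n) + 1" by (simp add: add.commute)
    moreover have "1 * 1 \<le> real n ^ 2 * (real k + 1) ^ n"
      using that by (intro mult_mono one_le_power) auto
    ultimately show ?thesis by linarith
  qed
  show "(\<lambda>(k, n). real (?l k n)) \<in>
      \<Theta>[principal ({2..} \<times> {1..})](\<lambda>(k, n). real n ^ 2 * (real k + 1) ^ n)"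
  proof (rule bigthetaI)
    show "(\<lambda>(k, n). real (?l k n)) \<in>
      O[principal ({2..} \<times> {1..})](\<lambda>(k, n). real n ^ 2 * (real k + 1) ^ n)"
      by (rule bigoI[of _ 9]) (use bounds in \<open>auto simp: eventually_principal\<close>)
    show "(\<lambda>(k, n). real (?l k n)) \<in>
      \<Omega>[principal ({2..} \<times> {1..})](\<lambda>(k, n). real n ^ 2 * (real k + 1) ^ n)"
      by (rule landau_omega.bigI[of 1]) (use bounds in \<open>auto simp: eventually_principal\<close>)
  qed
  fix k :: nat and \<gamma> :: "'a query"
  assume "2 \<le> k" "is_c2rpq \<gamma>"
  \<comment> \<open>\<open>Ref\<close> ranges over positive \<open>m\<close> only; the summand
    \<open>1\<close> keeps the bound positive for a query without atoms.\<close>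
  have "App_star_le (Tw k) (?l k (num_atoms \<gamma>)) \<gamma> \<subseteq> App_star (Tw k) \<gamma>"
    unfolding App_star_le_def App_star_def Ref_def by fastforce
  then show "equivalent_unions (App_star (Tw k) \<gamma>) (App_star_le (Tw k) (?l k (num_atoms \<gamma>)) \<gamma>)"
    unfolding equivalent_unions_def using App_star_shorten[OF \<open>is_c2rpq \<gamma>\<close>] by blast
qed

end
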